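(* Let $0<q<1$ and let $\xi,\eta$ be non-negative real numbers that are sufficiently small depending only on $q$. For every $w\in A$, the series $O(ywx)$ is absolutely convergent and \[ O(ywx)=O(y\tau_{\lambda}(w)x). \]
   Context: For a positive integer $m$, $[m]=\frac{1-q^m}{1-q}$. An admissible index is a non-empty tuple of positive integers $\boldsymbol{k}=(k_1,\dots,k_r)$ with $k_r\ge 2$. For such $\boldsymbol{k}$, \[ O(\boldsymbol{k})=\sum_{0<m_1<\cdots<m_r}\prod_{i=1}^r\frac{q^{(k_i-1)m_i}}{([m_i]-q^{m_i}\xi)([m_i]-q^{m_i}\eta)[m_i]^{k_i-2}}. \] An admissible index $(k_1,\dots,k_r)$ is identified with the word $yx^{k_1-1}\cdots yx^{k_r-1}\in y\mathbb{Q}\langle x,y\rangle x$ (non-commutative polynomials in $x,y$), and $O$ is extended $\mathbb{Q}$-linearly to a map $y\mathbb{Q}\langle x,y\rangle x\to\mathbb{R}$. Let $\lambda$ be an indeterminate; in $\mathbb{Q}\langle x,y\rangle[[\lambda]]$ set $\tau_\lambda(x)=(1+yx\lambda)^{-1}y=y(1+xy\lambda)^{-1}$ and $\tau_\lambda(y)=x(1+yx\lambda)=(1+xy\lambda)x$. Let $A$ be the subring of $\mathbb{Q}\langle x,y\rangle[[\lambda]]$ generated by $x,y,\lambda$ and $(1+yx\lambda)^{-1}$, and extend $\tau_\lambda$ to the $\mathbb{Q}$-anti-automorphism of $A$ with $\tau_\lambda(\lambda)=\lambda$ (so $\tau_\lambda((1+yx\lambda)^{-1})=(1+yx\lambda)^{-1}$).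 For $w=\sum_{i\ge0}w_i\lambda^i\in A$ (with $w_i\in\mathbb{Q}\langle x,y\rangle$), define $O(ywx)=\sum_{i\ge 0}O(yw_ix)\xi^i\eta^i$. *)

theory Defs
  imports
    "HOL-Library.Poly_Mapping"
    "HOL-Computational_Algebra.Formal_Power_Series"
    "HOL-Analysis.Infinite_Sum"
begin

text \<open>
  The free algebra over the rationals on \<open>x\<close>, \<open>y\<close> is the monoid algebra of the free monoid on
  two letters, i.e. finitely supported functions from words to the rationals with convolution.
  \<^theory>\<open>HOL-Library.Poly_Mapping\<close> writes the monoid additively, so addition of words below is
  (non-commutative) concatenation.
\<close>

datatype letter = X | Y

datatype word = Word (letters: "letter list")

instantiation word :: monoid_add
begin

definition zero_word :: word where "0 = Word []"

definition plus_word :: "word \<Rightarrow> word \<Rightarrow> word" where "v + w = Word (letters v @ letters w)"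

instance
  by standard (simp_all add: zero_word_def plus_word_def)

end

type_synonym nc_poly = "word \<Rightarrow>\<^sub>0 rat"

abbreviation monomial :: "letter list \<Rightarrow> nc_poly" where
  "monomial v \<equiv> Poly_Mapping.single (Word v) 1"

text \<open>
  In \<^typ>\<open>nc_poly fps\<close> the central indeterminate \<open>\<lambda>\<close> is \<^const>\<open>fps_X\<close>.
\<close>

definition gen_x :: "nc_poly fps" where "gen_x = fps_const (monomial [X])"

definition gen_y :: "nc_poly fps" where "gen_y = fps_const (monomial [Y])"

definition scalar :: "rat \<Rightarrow> nc_poly fps" where
  "scalar c = fps_const (Poly_Mapping.single 0 c)"

definition one_yx :: "nc_poly fps" where "one_yx = 1 + gen_y * gen_x * fps_X"

definition inv_yx :: "nc_poly fps" where "inv_yx = fps_left_inverse one_yx 1"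

lemma fps_X_central: "fps_X * (f :: nc_poly fps) = f * fps_X"
  by (simp add: fps_mult_fps_X_commute)

lemma inv_yx_left: "inv_yx * one_yx = 1"
  unfolding inv_yx_def by (rule fps_left_inverse) (simp add: one_yx_def)

lemma inv_yx_right: "one_yx * inv_yx = 1"
proof -
  have r: "one_yx * fps_right_inverse one_yx 1 = 1"
    by (rule fps_right_inverse) (simp add: one_yx_def)
  have "inv_yx = inv_yx * (one_yx * fps_right_inverse one_yx 1)"
    by (simp only: r mult_1_right)
  also have "\<dots> = fps_right_inverse one_yx 1"
    by (simp only: mult.assoc [symmetric] inv_yx_left mult_1_left)
  finally show ?thesis using r by simp
qed

text \<open>
  The rational scalars are among the generators (``subring'' is read as \<open>\<rat>\<close>-subalgebra, as needed for
  a \<open>\<rat>\<close>-anti-automorphism); closure under negation comes from multiplication by \<open>scalar (- 1)\<close>.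
\<close>

inductive_set alg_A :: "nc_poly fps set" where
  scalar: "scalar c \<in> alg_A"
| x: "gen_x \<in> alg_A"
| y: "gen_y \<in> alg_A"
| lam: "fps_X \<in> alg_A"
| inv: "inv_yx \<in> alg_A"
| add: "\<lbrakk>f \<in> alg_A; g \<in> alg_A\<rbrakk> \<Longrightarrow> f + g \<in> alg_A"
| mult: "\<lbrakk>f \<in> alg_A; g \<in> alg_A\<rbrakk> \<Longrightarrow> f * g \<in> alg_A"

text \<open>
  \<open>tau\<close> is given on all of \<^typ>\<open>nc_poly fps\<close> as the \<open>\<lambda>\<close>-linear, \<open>\<lambda>\<close>-adically continuous
  anti-endomorphism with the prescribed values on \<open>x\<close> and \<open>y\<close>: the coefficient of \<open>\<lambda>\<^sup>n\<close>
  in \<open>\<Sum>\<^sub>i tau (f\<^sub>i) \<lambda>\<^sup>i\<close> is a finite sum. That it restricts to the unique anti-automorphism of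
  \<^const>\<open>alg_A\<close> with these values is proved below.
\<close>

fun tau_letter :: "letter \<Rightarrow> nc_poly fps" where
  "tau_letter X = inv_yx * gen_y"
| "tau_letter Y = gen_x * one_yx"

definition tau_word :: "word \<Rightarrow> nc_poly fps" where
  "tau_word v = prod_list (rev (map tau_letter (letters v)))"

definition tau_poly :: "nc_poly \<Rightarrow> nc_poly fps" where
  "tau_poly p = (\<Sum>v\<in>Poly_Mapping.keys p. scalar (Poly_Mapping.lookup p v) * tau_word v)"

definition tau :: "nc_poly fps \<Rightarrow> nc_poly fps" where
  "tau f = Abs_fps (\<lambda>n. \<Sum>i\<le>n. fps_nth (tau_poly (fps_nth f i)) (n - i))"

lemma scalar_0 [simp]: "scalar 0 = 0"
  by (simp add: scalar_def)

lemma scalar_1 [simp]: "scalar 1 = 1"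
  by (simp add: scalar_def)

lemma scalar_add: "scalar (a + b) = scalar a + scalar b"
  by (simp add: scalar_def single_add)

lemma scalar_mult: "scalar (a * b) = scalar a * scalar b"
  by (simp add: scalar_def mult_single)

lemma nc_poly_induct [case_names zero single add]:
  fixes p :: nc_poly
  assumes zero: "P 0" and single: "\<And>v c. P (Poly_Mapping.single v c)"
    and add: "\<And>p r. \<lbrakk>P p; P r\<rbrakk> \<Longrightarrow> P (p + r)"
  shows "P p"
proof -
  have "P (\<Sum>v\<in>S. Poly_Mapping.single v (Poly_Mapping.lookup p v))" for S
    by (induction S rule: infinite_finite_induct) (simp_all add: zero single add)
  moreover have "(\<Sum>v\<in>Poly_Mapping.keys p. Poly_Mapping.single v (Poly_Mapping.lookup p v)) = p"
    by (rule poly_mapping_eqI)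
      (simp add: lookup_sum lookup_single when_def in_keys_iff)
  ultimately show ?thesis by metis
qed

lemma single_0_central: "Poly_Mapping.single 0 c * p = p * Poly_Mapping.single 0 c"
  for p :: nc_poly
proof (induction p rule: nc_poly_induct)
  case (single v c)
  then show ?case by (simp add: mult_single mult.commute)
next
  case (add p r)
  then show ?case by (simp add: distrib_left distrib_right)
qed simp

lemma scalar_central: "scalar c * f = f * scalar c"
  by (rule fps_ext) (simp add: scalar_def single_0_central)

lemma tau_word_0 [simp]: "tau_word 0 = 1"
  by (simp add: tau_word_def zero_word_def)

lemma tau_word_add: "tau_word (v + w) = tau_word w * tau_word v"
  by (simp add: tau_word_def plus_word_def)

lemma tau_poly_0 [simp]: "tau_poly 0 = 0"
  by (simp add: tau_poly_def)

lemma tau_poly_single: "tau_poly (Poly_Mapping.single v c) = scalar c * tau_word v"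
  by (simp add: tau_poly_def)

lemma tau_poly_add: "tau_poly (p + r) = tau_poly p + tau_poly r"
  unfolding tau_poly_def
  by (rule setsum_keys_plus_distrib) (simp_all add: scalar_add distrib_right)

lemma tau_poly_sum: "tau_poly (sum p I) = (\<Sum>i\<in>I. tau_poly (p i))"
  by (induction I rule: infinite_finite_induct) (simp_all add: tau_poly_add)

lemma tau_poly_mult: "tau_poly (p * r) = tau_poly r * tau_poly p"
proof (induction p rule: nc_poly_induct)
  case (single v c)
  show ?case
  proof (induction r rule: nc_poly_induct)
    case (single w d)
    have "scalar c * scalar d * (tau_word w * tau_word v) =
        scalar d * tau_word w * (scalar c * tau_word v)"
      by (simp add: mult.assoc scalar_central [of c])
    then show ?case
      by (simp add: mult_single tau_poly_single tau_word_add scalar_mult)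
  next
    case (add p r)
    then show ?case by (simp add: distrib_left distrib_right tau_poly_add)
  qed simp
next
  case (add p r)
  then show ?case by (simp add: distrib_left distrib_right tau_poly_add)
qed simp

lemma tau_nth: "fps_nth (tau f) n = (\<Sum>i\<le>n. fps_nth (tau_poly (fps_nth f i)) (n - i))"
  by (simp add: tau_def)

theorem tau_add: "tau (f + g) = tau f + tau g"
  by (rule fps_ext) (simp add: tau_nth tau_poly_add sum.distrib)

lemma tau_fps_const: "tau (fps_const p) = tau_poly p"
proof (rule fps_ext)
  fix n
  have "(\<Sum>i\<le>n. fps_nth (tau_poly (fps_nth (fps_const p) i)) (n - i)) =
      (\<Sum>i\<in>{0}. fps_nth (tau_poly (fps_nth (fps_const p) i)) (n - i))"
    by (rule sum.mono_neutral_right) auto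
  then show "fps_nth (tau (fps_const p)) n = fps_nth (tau_poly p) n"
    by (simp add: tau_nth)
qed

theorem tau_mult: "tau (f * g) = tau g * tau f"
proof (rule fps_ext)
  fix n
  define F where "F = (\<lambda>i k. fps_nth (tau_poly (fps_nth f i)) k)"
  define G where "G = (\<lambda>i k. fps_nth (tau_poly (fps_nth g i)) k)"
  have "fps_nth (tau (f * g)) n =
      (\<Sum>i\<le>n. \<Sum>j=0..i. \<Sum>k=0..n - i. G (i - j) k * F j (n - i - k))"
    by (simp add: tau_nth fps_mult_nth tau_poly_sum tau_poly_mult fps_sum_nth F_def G_def)
  also have "\<dots> = (\<Sum>(i, j, k)\<in>(SIGMA i:{..n}. SIGMA j:{0..i}. {0..n - i}).
      G (i - j) k * F j (n - i - k))"
    by (simp add: sum.Sigma)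
  also have "\<dots> = (\<Sum>(a, b, c)\<in>(SIGMA a:{0..n}. SIGMA b:{..a}. {..n - a}).
      G b (a - b) * F c (n - a - c))"
    by (rule sum.reindex_bij_witness
        [where i = "\<lambda>(a, b, c). (b + c, c, a - b)" and j = "\<lambda>(i, j, k). (i - j + k, i - j, j)"])
      auto
  also have "\<dots> = (\<Sum>a=0..n. \<Sum>b\<le>a. \<Sum>c\<le>n - a. G b (a - b) * F c (n - a - c))"
    by (simp add: sum.Sigma)
  also have "\<dots> = fps_nth (tau g * tau f) n"
    by (simp add: tau_nth fps_mult_nth F_def G_def sum_product)
  finally show "fps_nth (tau (f * g)) n = fps_nth (tau g * tau f) n" .
qed

theorem tau_scalar: "tau (scalar c) = scalar c"
  by (simp add: scalar_def tau_fps_const tau_poly_single)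

lemma tau_1: "tau 1 = 1"
  using tau_scalar [of 1] by simp

theorem tau_x: "tau gen_x = inv_yx * gen_y"
  by (simp add: gen_x_def tau_fps_const tau_poly_single tau_word_def)

theorem tau_y: "tau gen_y = gen_x * one_yx"
  by (simp add: gen_y_def tau_fps_const tau_poly_single tau_word_def)

theorem tau_lambda: "tau fps_X = fps_X"
proof (rule fps_ext)
  fix n
  have "(\<Sum>i\<le>n. fps_nth (tau_poly (fps_nth fps_X i)) (n - i)) =
      (\<Sum>i\<in>{1} \<inter> {..n}. fps_nth (tau_poly (fps_nth fps_X i)) (n - i))"
    by (rule sum.mono_neutral_right) auto
  also have "\<dots> = fps_nth fps_X n"
  proof -
    have "tau_poly 1 = 1"
      using tau_poly_single [of 0 1] by simp
    then show ?thesis by (cases "n = 0") auto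
  qed
  finally show "fps_nth (tau fps_X) n = fps_nth fps_X n"
    by (simp add: tau_nth)
qed

lemma tau_one_yx: "tau one_yx = one_yx"
proof -
  define z where "z = gen_y * gen_x"
  have z: "one_yx = 1 + z * fps_X" by (simp add: one_yx_def z_def)
  have "z * one_yx = one_yx * z"
    by (simp add: z distrib_left distrib_right mult.assoc fps_X_central)
  then have "inv_yx * (z * one_yx) = z"
    by (simp add: mult.assoc [symmetric] inv_yx_left)
  then have "tau z = z"
    by (simp add: z_def tau_mult tau_x tau_y mult.assoc)
  then show ?thesis
    by (simp add: z tau_add tau_1 tau_mult tau_lambda fps_X_central)
qed

theorem tau_inv_yx: "tau inv_yx = inv_yx"
proof -
  have "one_yx * tau inv_yx = tau (inv_yx * one_yx)"
    by (simp add: tau_mult tau_one_yx)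
  also have "\<dots> = 1" by (simp add: inv_yx_left tau_1)
  finally have "inv_yx * (one_yx * tau inv_yx) = inv_yx" by simp
  then show ?thesis by (simp add: mult.assoc [symmetric] inv_yx_left)
qed

lemma one_yx_in_A: "one_yx \<in> alg_A"
  using alg_A.scalar [of 1] by (auto simp: one_yx_def intro!: alg_A.intros)

lemma tau_in_A: "f \<in> alg_A \<Longrightarrow> tau f \<in> alg_A"
  by (induction rule: alg_A.induct)
    (simp_all add: tau_scalar tau_x tau_y tau_lambda tau_inv_yx tau_add tau_mult
      alg_A.intros one_yx_in_A)

lemma tau_tau: "f \<in> alg_A \<Longrightarrow> tau (tau f) = f"
proof (induction rule: alg_A.induct)
  case x
  show ?case
    by (simp add: tau_x tau_y tau_mult tau_inv_yx mult.assoc inv_yx_right)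
next
  case y
  show ?case
    by (simp add: tau_x tau_y tau_mult tau_one_yx mult.assoc [symmetric] inv_yx_right)
qed (simp_all add: tau_scalar tau_lambda tau_inv_yx tau_add tau_mult)

theorem tau_bij: "bij_betw tau alg_A alg_A"
  by (rule bij_betw_byWitness [where f' = tau]) (auto simp: tau_tau tau_in_A)

theorem tau_unique:
  assumes "\<And>f g. \<lbrakk>f \<in> alg_A; g \<in> alg_A\<rbrakk> \<Longrightarrow> t (f + g) = t f + t g"
    and "\<And>f g. \<lbrakk>f \<in> alg_A; g \<in> alg_A\<rbrakk> \<Longrightarrow> t (f * g) = t g * t f"
    and "\<And>c. t (scalar c) = scalar c"
    and "t gen_x = inv_yx * gen_y" and "t gen_y = gen_x * one_yx" and "t fps_X = fps_X"
    and "f \<in> alg_A"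
  shows "t f = tau f"
  using assms(7)
proof (induction rule: alg_A.induct)
  case inv
  have 1: "1 \<in> alg_A" using alg_A.scalar [of 1] by simp
  have "t one_yx = 1 + fps_X * (t gen_x * t gen_y)"
    unfolding one_yx_def using assms(3) [of 1]
    by (simp add: assms(1,2,6) alg_A.intros 1)
  also have "\<dots> = tau one_yx"
    by (simp add: assms(4,5) tau_x tau_y tau_mult tau_add tau_1 tau_lambda
        one_yx_def [THEN arg_cong [where f = tau]])
  finally have "t one_yx = one_yx" by (simp add: tau_one_yx)
  then have "one_yx * t inv_yx = t (inv_yx * one_yx)"
    by (simp add: assms(2) alg_A.intros one_yx_in_A)
  also have "\<dots> = 1" using assms(3) [of 1] by (simp add: inv_yx_left)
  finally have "inv_yx * (one_yx * t inv_yx) = inv_yx" by simp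
  then show ?case by (simp add: mult.assoc [symmetric] inv_yx_left tau_inv_yx)
qed (simp_all add: assms tau_scalar tau_x tau_y tau_lambda tau_add tau_mult)

definition admissible :: "nat list \<Rightarrow> bool" where
  "admissible ks \<longleftrightarrow> ks \<noteq> [] \<and> (\<forall>k\<in>set ks. 1 \<le> k) \<and> 2 \<le> last ks"

definition index_word :: "nat list \<Rightarrow> word" where
  "index_word ks = Word (concat (map (\<lambda>k. Y # replicate (k - 1) X) ks))"

definition qbracket :: "real \<Rightarrow> nat \<Rightarrow> real" where
  "qbracket q m = (1 - q ^ m) / (1 - q)"

definition increasing_tuples :: "nat \<Rightarrow> nat list set" where
  "increasing_tuples r = {ms. length ms = r \<and> sorted_wrt (<) ms \<and> (\<forall>m\<in>set ms. 0 < m)}"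

definition O_term :: "real \<Rightarrow> real \<Rightarrow> real \<Rightarrow> nat list \<Rightarrow> nat list \<Rightarrow> real" where
  "O_term q \<xi> \<eta> ks ms = (\<Prod>i<length ks.
     q ^ ((ks ! i - 1) * ms ! i) /
     ((qbracket q (ms ! i) - q ^ (ms ! i) * \<xi>) * (qbracket q (ms ! i) - q ^ (ms ! i) * \<eta>) *
      qbracket q (ms ! i) powi (int (ks ! i) - 2)))"

definition O_index :: "real \<Rightarrow> real \<Rightarrow> real \<Rightarrow> nat list \<Rightarrow> real" where
  "O_index q \<xi> \<eta> ks = (\<Sum>\<^sub>\<infinity>ms\<in>increasing_tuples (length ks). O_term q \<xi> \<eta> ks ms)"

text \<open>
  The linear extension of \<^const>\<open>O_index\<close> to the span of the words that start with \<open>y\<close> and end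
  with \<open>x\<close>. By \<open>bij_betw_index_word\<close> below, these are exactly the words of admissible indices.
\<close>

definition O_poly :: "real \<Rightarrow> real \<Rightarrow> real \<Rightarrow> nc_poly \<Rightarrow> real" where
  "O_poly q \<xi> \<eta> p = (\<Sum>ks | admissible ks \<and> index_word ks \<in> Poly_Mapping.keys p.
     of_rat (Poly_Mapping.lookup p (index_word ks)) * O_index q \<xi> \<eta> ks)"

lemma letters_index_word_Nil [simp]: "letters (index_word []) = []"
  by (simp add: index_word_def)

lemma letters_index_word_Cons [simp]:
  "letters (index_word (k # ks)) = Y # replicate (k - 1) X @ letters (index_word ks)"
  by (simp add: index_word_def)

lemma index_word_inj:
  assumes "index_word ks = index_word ls" and "\<forall>k\<in>set ks. 1 \<le> k" and "\<forall>l\<in>set ls. 1 \<le> l"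
  shows "ks = ls"
  using assms
proof (induction ks arbitrary: ls)
  case Nil
  then show ?case
    by (cases ls) (auto simp: index_word_def)
next
  case (Cons k ks)
  then obtain l ls' where ls: "ls = l # ls'"
    by (cases ls) (auto simp: index_word_def)
  have *: "takeWhile (\<lambda>a. a = X) (replicate n X @ letters (index_word js)) = replicate n X" for n js
    by (cases js) (simp_all add: takeWhile_append)
  have eq: "replicate (k - 1) X @ letters (index_word ks) =
      replicate (l - 1) X @ letters (index_word ls')"
    using arg_cong [OF Cons.prems(1), of letters] by (simp add: ls)
  then have "replicate (k - 1) X = replicate (l - 1) X"
    using * [of "k - 1" ks] * [of "l - 1" ls'] by simp
  from arg_cong [OF this, of length] have kl: "k - 1 = l - 1"
    by simp
  with eq have "index_word ks = index_word ls'"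
    by (simp add: word.expand)
  then have "ks = ls'" using Cons ls by auto
  with kl Cons.prems ls show ?case by force
qed

lemma index_word_surj:
  "\<exists>ks. index_word ks = Word (Y # v) \<and> ks \<noteq> [] \<and> (\<forall>k\<in>set ks. 1 \<le> k)"
proof (induction v)
  case Nil
  show ?case by (rule exI [of _ "[1]"]) (simp add: index_word_def)
next
  case (Cons a v)
  then obtain k ks where ks: "index_word (k # ks) = Word (Y # v)" "\<forall>k\<in>set (k # ks). 1 \<le> k"
    by (metis list.exhaust)
  show ?case
  proof (cases a)
    case Y
    with ks show ?thesis
      by (intro exI [of _ "1 # k # ks"]) (auto simp: index_word_def)
  next
    case X
    from ks have "k \<noteq> 0" by auto
    then obtain n where "k = Suc n" by (cases k) auto
    with X ks show ?thesis
      by (intro exI [of _ "Suc k # ks"]) (auto simp: index_word_def)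
  qed
qed

theorem bij_betw_index_word:
  "bij_betw index_word {ks. admissible ks} {Word (Y # v @ [X]) | v. True}"
proof (rule bij_betwI')
  fix ks ls assume "ks \<in> {ks. admissible ks}" "ls \<in> {ks. admissible ks}"
  then show "(index_word ks = index_word ls) = (ks = ls)"
    using index_word_inj by (auto simp: admissible_def)
next
  fix ks assume "ks \<in> {ks. admissible ks}"
  then have ks: "ks \<noteq> []" "2 \<le> last ks" by (auto simp: admissible_def)
  define js where "js = butlast ks"
  define n where "n = last ks - 2"
  have "ks = js @ [Suc (Suc n)]"
  proof -
    have "Suc (Suc n) = last ks" using ks by (simp add: n_def)
    then show ?thesis using ks by (simp add: js_def)
  qed
  then have "index_word ks = Word (letters (index_word js) @ Y # replicate n X @ [X])"
    by (simp add: index_word_def replicate_append_same)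
  moreover have "\<exists>v. letters (index_word js) @ Y # replicate n X @ [X] = Y # v @ [X]"
    by (cases js) auto
  ultimately show "index_word ks \<in> {Word (Y # v @ [X]) | v. True}" by auto
next
  fix w assume "w \<in> {Word (Y # v @ [X]) | v. True}"
  then obtain v where w: "w = Word (Y # v @ [X])" by auto
  obtain ks where ks: "index_word ks = w" "ks \<noteq> []" "\<forall>k\<in>set ks. 1 \<le> k"
    using index_word_surj [of "v @ [X]"] w by auto
  define js where "js = butlast ks"
  have ks': "ks = js @ [last ks]"
    using ks by (simp add: js_def)
  have "last ks \<noteq> 1"
  proof
    assume "last ks = 1"
    then have "letters (index_word ks) = letters (index_word js) @ [Y]"
      by (subst ks') (simp add: index_word_def)
    then have "last (letters (index_word ks)) = Y" by simp
    moreover have "last (letters (index_word ks)) = X" by (simp add: ks(1) w)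
    ultimately show False by simp
  qed
  moreover have "1 \<le> last ks" using ks by simp
  ultimately have "2 \<le> last ks" by linarith
  then have "admissible ks" using ks by (simp add: admissible_def)
  with ks show "\<exists>ks\<in>{ks. admissible ks}. w = index_word ks" by auto
qed

lemma inj_on_index_word: "inj_on index_word {ks. admissible ks}"
  using bij_betw_index_word by (rule bij_betw_imp_inj_on)

lemma finite_index_keys:
  "finite {ks. admissible ks \<and> index_word ks \<in> Poly_Mapping.keys p}"
  by (rule finite_imageD [OF finite_subset [OF _ finite_keys [of p]]])
    (auto intro: inj_on_subset [OF inj_on_index_word])

lemma O_poly_index:
  assumes "admissible ks"
  shows "O_poly q \<xi> \<eta> (Poly_Mapping.single (index_word ks) c) = of_rat c * O_index q \<xi> \<eta> ks"
proof -
  have "{ls. admissible ls \<and> index_word ls = index_word ks} = {ks}"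
    using assms inj_on_index_word by (auto dest: inj_onD)
  then show ?thesis
    by (cases "c = 0") (simp_all add: O_poly_def)
qed

lemma O_poly_add: "O_poly q \<xi> \<eta> (p + r) = O_poly q \<xi> \<eta> p + O_poly q \<xi> \<eta> r"
proof -
  define S where "S = {ks. admissible ks \<and> index_word ks \<in> Poly_Mapping.keys p \<union> Poly_Mapping.keys r}"
  have "finite S"
    using finite_index_keys [of p] finite_index_keys [of r]
    by (auto simp: S_def conj_disj_distribL Collect_disj_eq)
  have *: "O_poly q \<xi> \<eta> s =
      (\<Sum>ks\<in>S. of_rat (Poly_Mapping.lookup s (index_word ks)) * O_index q \<xi> \<eta> ks)"
    if "Poly_Mapping.keys s \<subseteq> Poly_Mapping.keys p \<union> Poly_Mapping.keys r" for s
    unfolding O_poly_def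
    by (rule sum.mono_neutral_left) (use that \<open>finite S\<close> in \<open>auto simp: S_def in_keys_iff\<close>)
  show ?thesis
    using keys_add [of p r]
    by (simp add: * lookup_add of_rat_add distrib_right sum.distrib)
qed

definition O_series :: "real \<Rightarrow> real \<Rightarrow> real \<Rightarrow> nc_poly fps \<Rightarrow> real" where
  "O_series q \<xi> \<eta> W = suminf (\<lambda>i. O_poly q \<xi> \<eta> (fps_nth W i) * \<xi> ^ i * \<eta> ^ i)"

end

theory Submission
  imports
    Defs
    "HOL-Analysis.Bounded_Linear_Function"
    "HOL-Analysis.Bounded_Continuous_Function"
    "HOL-Analysis.Infinite_Products"
begin

text \<open>
  Let \<open>X\<close> multiply a function of \<open>m\<close> by \<open>x\<^sub>m = q\<^sup>m / [m]\<close> and let \<open>(Y f) m\<close> be the sum over \<open>a > m\<close>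
  of \<open>y\<^sub>a f a\<close>, where \<open>y\<^sub>a = [a] / (([a] - q\<^sup>a \<xi>) ([a] - q\<^sup>a \<eta>))\<close>. Then \<open>O\<close> of a word is the word,
  acting on the constant function 1, evaluated at 0. With \<open>\<alpha> = 1 + (1 - q) \<xi>\<close> and
  \<open>\<beta> = 1 + (1 - q) \<eta>\<close> put \<open>C m n = K q\<^sup>m\<^sup>n F(m) F(n) / G(m + n)\<close>, where \<open>F(m)\<close> is the product of
  \<open>(1 - \<alpha> q\<^sup>a) (1 - \<beta> q\<^sup>a) / (1 - q\<^sup>a)\<close> and \<open>G(m)\<close> that of \<open>1 - \<alpha> \<beta> q\<^sup>a\<close> over \<open>1 \<le> a \<le> m\<close>, and
  \<open>K = lim G / lim F\<close>. The quotient \<open>C (m - 1) n / C m n\<close> is \<open>1 - \<xi> \<eta> y\<^sub>m x\<^sub>m + y\<^sub>m / x\<^sub>n\<close>, and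
  telescoping gives \<open>(Y X)\<^sub>m C = (Y X)\<^sub>n C\<close> and \<open>Y\<^sub>m C = X\<^sub>n (1 + \<xi> \<eta> Y X)\<^sub>n C\<close>, where the subscript
  names the variable acted upon. As actions in different variables commute and \<open>\<tau>\<close> reverses
  products, \<open>w\<^sub>m C = (\<tau> w)\<^sub>n C\<close> for all \<open>w\<close> in \<open>A\<close>. Since moreover \<open>(Y\<^sub>n C)(m, 0) = x\<^sub>m\<close>, both
  \<open>O(y w x)\<close> and \<open>O(y \<tau>(w) x)\<close> equal \<open>Y\<^sub>m Y\<^sub>n w\<^sub>m C\<close> at \<open>(0, 0)\<close>.

  Convergence is that of a Neumann series: \<open>X\<close> and \<open>Y\<close> are bounded on functions that are
  \<open>O(q\<^sup>m)\<close>, so \<open>1 + \<xi> \<eta> Y X\<close> is invertible for small \<open>\<xi> \<eta>\<close>.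
\<close>

section \<open>Infinite sums and products\<close>

lemma has_sum_diff:
  fixes f g :: "'a \<Rightarrow> 'b::topological_ab_group_add"
  assumes "(f has_sum a) A" and "(g has_sum b) A"
  shows "((\<lambda>x. f x - g x) has_sum a - b) A"
  using has_sum_add [OF assms(1), of "\<lambda>x. - g x" "- b"] assms(2) by (simp add: has_sum_uminus)

lemma infsum_greaterThan_Suc:
  fixes f :: "nat \<Rightarrow> 'a::banach"
  assumes "f summable_on {m<..}"
  shows "infsum f {m<..} = f (Suc m) + infsum f {Suc m<..}"
proof -
  have "{m<..} = insert (Suc m) {Suc m<..}" by auto
  moreover have "f summable_on {Suc m<..}"
    by (rule summable_on_subset_banach [OF assms]) auto
  ultimately show ?thesis by (simp add: infsum_insert)
qed

lemma infsum_greaterThan_tendsto_0: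
  fixes f :: "nat \<Rightarrow> 'a::banach"
  assumes "f summable_on UNIV"
  shows "(\<lambda>m. infsum f {m<..}) \<longlonglongrightarrow> 0"
proof -
  have "infsum f {m<..} = infsum f UNIV - sum f {..m}" for m
  proof -
    have "f summable_on A" for A
      by (rule summable_on_subset_banach [OF assms]) simp
    then have "infsum f ({..m} \<union> {m<..}) = sum f {..m} + infsum f {m<..}"
      by (subst infsum_Un_disjoint) auto
    moreover have "{..m} \<union> {m<..} = UNIV" by auto
    ultimately show ?thesis by simp
  qed
  moreover have "(\<lambda>m. sum f {..m}) \<longlonglongrightarrow> infsum f UNIV"
    using has_sum_imp_sums [OF has_sum_infsum [OF assms]] by (simp add: sums_def_le)
  then have "(\<lambda>m. infsum f UNIV - sum f {..m}) \<longlonglongrightarrow> infsum f UNIV - infsum f UNIV"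
    by (intro tendsto_intros)
  ultimately show ?thesis by simp
qed

lemma infsum_greaterThan_telescope:
  fixes f g :: "nat \<Rightarrow> 'a::banach"
  assumes f: "f summable_on {m<..}" and diff: "\<And>k. g k - g (Suc k) = f (Suc k)"
    and g: "g \<longlonglongrightarrow> c"
  shows "infsum f {m<..} = g m - c"
proof -
  have "((\<lambda>k. f (Suc (m + k))) has_sum infsum f {m<..}) UNIV"
    by (rule has_sum_reindex_bij_witness
        [where i = "\<lambda>a. a - Suc m" and j = "\<lambda>k. Suc (m + k)", THEN iffD2, rotated -1,
          OF has_sum_infsum [OF f]]) auto
  then have "(\<lambda>k. g (m + k) - g (m + Suc k)) sums infsum f {m<..}"
    by (simp add: diff has_sum_imp_sums)
  moreover have "(\<lambda>k. g (m + k)) \<longlonglongrightarrow> c"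
    using LIMSEQ_ignore_initial_segment [OF g, of m] by (simp add: add.commute)
  then have "(\<lambda>k. g (m + k) - g (m + Suc k)) sums (g (m + 0) - c)"
    by (rule telescope_sums')
  ultimately show ?thesis by (simp add: sums_unique2)
qed

lemma has_sum_geometric_shift:
  fixes q :: real
  assumes "\<bar>q\<bar> < 1"
  shows "((\<lambda>n. if s \<le> n then c * q ^ (n - s) else 0) has_sum c / (1 - q)) UNIV"
proof -
  have "((\<lambda>k. q ^ k) has_sum 1 / (1 - q)) UNIV"
    using assms by (intro norm_summable_imp_has_sum geometric_sums) (simp_all add: power_abs)
  then have "((\<lambda>k. c * q ^ k) has_sum c / (1 - q)) UNIV"
    using has_sum_cmult_right [of "\<lambda>k. q ^ k" UNIV "1 / (1 - q)" c] by simp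
  then have "((\<lambda>n. c * q ^ (n - s)) has_sum c / (1 - q)) {s..}"
    by (rule has_sum_reindex_bij_witness
        [where i = "\<lambda>n. n - s" and j = "\<lambda>k. s + k", THEN iffD1, rotated -1]) auto
  then show ?thesis
    by (rule has_sum_cong_neutral [THEN iffD1, rotated -1]) auto
qed

lemma
  fixes f :: "nat \<Rightarrow> real"
  assumes q: "\<bar>q\<bar> < 1" and f: "\<And>n. \<bar>f n\<bar> \<le> (if s \<le> n then c * q ^ (n - s) else 0)"
  shows abs_summable_on_geometric_bound: "f abs_summable_on UNIV"
    and infsum_abs_geometric_bound: "(\<Sum>\<^sub>\<infinity>n. \<bar>f n\<bar>) \<le> c / (1 - q)"
proof -
  note geometric = has_sum_geometric_shift [OF q, of s c]
  show summable: "f abs_summable_on UNIV"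
    by (rule abs_summable_on_comparison_test' [OF has_sum_imp_summable [OF geometric]])
      (simp only: real_norm_def f)
  show "(\<Sum>\<^sub>\<infinity>n. \<bar>f n\<bar>) \<le> c / (1 - q)"
    by (rule has_sum_mono [OF has_sum_infsum [OF summable [simplified]] geometric])
      (simp only: real_norm_def f)
qed

lemma summable_on_geometric_bound:
  fixes f :: "nat \<Rightarrow> real"
  assumes "\<bar>q\<bar> < 1" and "\<And>n. \<bar>f n\<bar> \<le> c * q ^ n"
  shows "f summable_on A"
proof -
  have "f abs_summable_on UNIV"
    using assms by (intro abs_summable_on_geometric_bound [where q = q and s = 0 and c = c]) auto
  then show ?thesis
    by (rule summable_on_subset_banach [OF abs_summable_summable]) simp
qed

definition qprod :: "real \<Rightarrow> real \<Rightarrow> nat \<Rightarrow> real" where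
  "qprod q t n = (\<Prod>k<n. 1 - t * q ^ Suc k)"

lemma qprod_0 [simp]: "qprod q t 0 = 1"
  by (simp add: qprod_def)

lemma qprod_Suc: "qprod q t (Suc n) = qprod q t n * (1 - t * q ^ Suc n)"
  by (simp add: qprod_def)

lemma qprod_tendsto_nonzero:
  assumes "\<bar>q\<bar> < 1" and nz: "\<And>n. t * q ^ Suc n \<noteq> 1"
  obtains l where "l \<noteq> 0" and "qprod q t \<longlonglongrightarrow> l"
proof
  define f where "f k = 1 - t * q ^ Suc k" for k
  have "summable (\<lambda>k. norm (- (t * q) * q ^ k))"
    using assms(1) by (simp add: abs_mult power_abs summable_mult)
  then have "summable (\<lambda>k. norm (f k - 1))"
    by (simp add: f_def mult.assoc)
  then have f: "convergent_prod f"
    by (intro abs_convergent_prod_imp_convergent_prod summable_imp_abs_convergent_prod)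
  show "prodinf f \<noteq> 0"
    using nz by (intro prodinf_nonzero [OF f]) (metis f_def eq_iff_diff_eq_0)
  have "(\<lambda>n. qprod q t (Suc n)) \<longlonglongrightarrow> prodinf f"
    using convergent_prod_LIMSEQ [OF f] unfolding qprod_def f_def lessThan_Suc_atMost .
  then show "qprod q t \<longlonglongrightarrow> prodinf f"
    by (rule LIMSEQ_imp_Suc)
qed

section \<open>Cauchy products under bounded bilinear maps\<close>

lemma abs_summable_on_bilinear_Times:
  fixes pr :: "'a::real_normed_vector \<Rightarrow> 'b::real_normed_vector \<Rightarrow> 'c::real_normed_vector"
  assumes "bounded_bilinear pr" and f: "f abs_summable_on A" and g: "g abs_summable_on B"
  shows "(\<lambda>(x, y). pr (f x) (g y)) abs_summable_on A \<times> B"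
proof -
  obtain K where K: "\<And>a b. norm (pr a b) \<le> norm a * norm b * K"
    using bounded_bilinear.bounded [OF assms(1)] by blast
  have "(\<lambda>(x, y). norm (f x) * norm (g y)) summable_on A \<times> B"
  proof (rule summable_on_SigmaI)
    show "((\<lambda>y. case (x, y) of (x, y) \<Rightarrow> norm (f x) * norm (g y)) has_sum
        norm (f x) * (\<Sum>\<^sub>\<infinity>y\<in>B. norm (g y))) B" for x
      using has_sum_cmult_right [OF has_sum_infsum [OF g]] by simp
    show "(\<lambda>x. norm (f x) * (\<Sum>\<^sub>\<infinity>y\<in>B. norm (g y))) summable_on A"
      by (rule summable_on_cmult_left [OF f])
  qed simp
  then have "(\<lambda>z. (case z of (x, y) \<Rightarrow> norm (f x) * norm (g y)) * K) summable_on A \<times> B"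
    by (rule summable_on_cmult_left)
  then show ?thesis
    by (rule abs_summable_on_comparison_test') (auto simp: K)
qed

lemma has_sum_bilinear_Times:
  fixes pr :: "'a::real_normed_vector \<Rightarrow> 'b::real_normed_vector \<Rightarrow> 'c::banach"
  assumes pr: "bounded_bilinear pr"
    and f: "f abs_summable_on A" "(f has_sum a) A" and g: "g abs_summable_on B" "(g has_sum b) B"
  shows "((\<lambda>(x, y). pr (f x) (g y)) has_sum pr a b) (A \<times> B)"
proof (rule has_sum_SigmaI)
  show "((\<lambda>y. case (x, y) of (x, y) \<Rightarrow> pr (f x) (g y)) has_sum pr (f x) b) B" for x
    using has_sum_bounded_linear [OF bounded_bilinear.bounded_linear_right [OF pr] g(2)] by simp
  show "((\<lambda>x. pr (f x) b) has_sum pr a b) A"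
    by (rule has_sum_bounded_linear [OF bounded_bilinear.bounded_linear_left [OF pr] f(2)])
  show "(\<lambda>(x, y). pr (f x) (g y)) summable_on A \<times> B"
    by (rule abs_summable_summable [OF abs_summable_on_bilinear_Times [OF pr f(1) g(1)]])
qed

lemma Cauchy_product_bilinear_sums:
  fixes pr :: "'a::banach \<Rightarrow> 'b::banach \<Rightarrow> 'c::banach"
  assumes pr: "bounded_bilinear pr"
    and f: "summable (\<lambda>i. norm (f i))" and g: "summable (\<lambda>i. norm (g i))"
  shows "(\<lambda>n. \<Sum>i\<le>n. pr (f i) (g (n - i))) sums pr (suminf f) (suminf g)"
proof -
  have "f abs_summable_on UNIV" "g abs_summable_on UNIV"
    using f g by (simp_all add: summable_nonneg_imp_summable_on)
  moreover have "(f has_sum suminf f) UNIV" "(g has_sum suminf g) UNIV"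
    using f g by (auto intro!: norm_summable_imp_has_sum summable_sums summable_norm_cancel)
  ultimately have "((\<lambda>(i, j). pr (f i) (g j)) has_sum pr (suminf f) (suminf g)) (UNIV \<times> UNIV)"
    using has_sum_bilinear_Times [OF pr] by blast
  then have "((\<lambda>(n, i). pr (f i) (g (n - i))) has_sum pr (suminf f) (suminf g))
      (SIGMA n:UNIV. {..n})"
    by (rule has_sum_reindex_bij_witness
        [where i = "\<lambda>(n, i). (i, n - i)" and j = "\<lambda>(i, j). (i + j, i)", THEN iffD1, rotated -1])
      auto
  then have "((\<lambda>n. \<Sum>i\<le>n. pr (f i) (g (n - i))) has_sum pr (suminf f) (suminf g)) UNIV"
    by (rule has_sum_SigmaD) (auto intro: has_sum_finiteI)
  then show ?thesis
    by (rule has_sum_imp_sums)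
qed

section \<open>Bounded sequences\<close>

text \<open>The library has completeness of \<open>\<Rightarrow>\<^sub>C\<close> over metric spaces only.\<close>

instantiation nat :: metric_space
begin

definition dist_nat :: "nat \<Rightarrow> nat \<Rightarrow> real" where "dist m n = \<bar>real m - real n\<bar>"

definition uniformity_nat :: "(nat \<times> nat) filter" where
  "uniformity = (INF e\<in>{0<..}. principal {(m, n :: nat). dist m n < e})"

instance
proof
  have eq_if_dist_less_1: "n = m" if "dist m n < 1" for m n :: nat
    using that by (simp add: dist_nat_def)
  show "open U \<longleftrightarrow> (\<forall>m\<in>U. \<forall>\<^sub>F (m', n) in uniformity. m' = m \<longrightarrow> n \<in> U)" for U :: "nat set"
    unfolding uniformity_nat_def
    by (auto intro!: open_discrete eventually_INF1 [of 1] simp: eventually_principal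
        dest: eq_if_dist_less_1)
qed (auto simp: dist_nat_def uniformity_nat_def)

end

instance bcontfun :: (metric_space, banach) banach ..

lemma apply_Bcontfun_nat:
  fixes f :: "nat \<Rightarrow> 'a::real_normed_vector"
  assumes "\<And>m. norm (f m) \<le> B"
  shows "apply_bcontfun (Bcontfun f) = f"
  using assms by (intro Bcontfun_inverse bcontfun_normI) auto

definition seq_op ::
    "(nat \<Rightarrow> 'a::real_normed_vector \<Rightarrow>\<^sub>L 'b::real_normed_vector) \<Rightarrow> 'a \<Rightarrow>\<^sub>L (nat \<Rightarrow>\<^sub>C 'b)" where
  "seq_op T = Blinfun (\<lambda>h. Bcontfun (\<lambda>m. T m h))"

lemma
  assumes norm_T: "\<And>m. norm (T m) \<le> B"
  shows seq_op_apply: "seq_op T h m = T m h"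
    and norm_seq_op_le: "norm (seq_op T) \<le> B"
proof -
  have norm_T_apply: "norm (T m h) \<le> B * norm h" for m h
    using norm_blinfun [of "T m" h] mult_right_mono [OF norm_T, of "norm h" m] by simp
  define S where "S h = Bcontfun (\<lambda>m. T m h)" for h
  have S_apply: "S h m = T m h" for h m
    by (simp add: S_def apply_Bcontfun_nat [OF norm_T_apply])
  have norm_S: "norm (S h) \<le> B * norm h" for h
    by (rule norm_bound) (simp add: S_apply norm_T_apply)
  have "bounded_linear S"
    by (rule bounded_linear_intro [where K = B])
      (auto intro!: bcontfun_eqI simp: S_apply blinfun.bilinear_simps norm_S mult.commute)
  then have seq_op_eq: "seq_op T h = S h" for h
    by (simp add: seq_op_def bounded_linear_Blinfun_apply flip: S_def)
  show "seq_op T h m = T m h"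
    by (simp add: seq_op_eq S_apply)
  have "0 \<le> B"
    using norm_ge_zero norm_T by (rule order_trans)
  then show "norm (seq_op T) \<le> B"
    by (rule norm_blinfun_bound) (simp add: seq_op_eq norm_S)
qed

definition eval_op :: "'a::topological_space \<Rightarrow> ('a \<Rightarrow>\<^sub>C 'b::real_normed_vector) \<Rightarrow>\<^sub>L 'b" where
  "eval_op m = Blinfun (\<lambda>h. apply_bcontfun h m)"

lemma eval_op_apply [simp]:
  fixes h :: "'a::topological_space \<Rightarrow>\<^sub>C 'b::real_normed_vector"
  shows "eval_op m h = h m"
proof -
  have "bounded_linear (\<lambda>h :: 'a \<Rightarrow>\<^sub>C 'b. apply_bcontfun h m)"
    by (rule bounded_linear_intro [where K = 1]) (auto simp: norm_bounded)
  then show ?thesis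
    by (simp add: eval_op_def bounded_linear_Blinfun_apply)
qed

lemma norm_eval_op_le: "norm (eval_op m) \<le> 1"
  by (rule norm_blinfun_bound) (simp_all add: norm_bounded)

definition sum_op :: "('a::topological_space \<Rightarrow> real) \<Rightarrow> ('a \<Rightarrow>\<^sub>C 'b::banach) \<Rightarrow>\<^sub>L 'b" where
  "sum_op k = Blinfun (\<lambda>h. \<Sum>\<^sub>\<infinity>a. k a *\<^sub>R apply_bcontfun h a)"

lemma abs_summable_on_scaleR_bcontfun:
  assumes "k abs_summable_on A"
  shows "(\<lambda>a. k a *\<^sub>R apply_bcontfun h a) abs_summable_on A"
proof (rule abs_summable_on_comparison_test')
  show "(\<lambda>a. norm (k a) * norm h) summable_on A"
    by (rule summable_on_cmult_left [OF assms])
qed (simp add: mult_left_mono norm_bounded)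

lemma norm_infsum_scaleR_bcontfun_le:
  fixes h :: "'a::topological_space \<Rightarrow>\<^sub>C 'b::banach"
  assumes k: "k abs_summable_on A"
  shows "norm (\<Sum>\<^sub>\<infinity>a\<in>A. k a *\<^sub>R h a) \<le> (\<Sum>\<^sub>\<infinity>a\<in>A. \<bar>k a\<bar>) * norm h"
proof -
  note abs_summable = abs_summable_on_scaleR_bcontfun [OF k]
  have "norm (\<Sum>\<^sub>\<infinity>a\<in>A. k a *\<^sub>R h a) \<le> (\<Sum>\<^sub>\<infinity>a\<in>A. norm (k a *\<^sub>R h a))"
    by (rule norm_infsum_bound [OF abs_summable])
  also have "\<dots> \<le> (\<Sum>\<^sub>\<infinity>a\<in>A. \<bar>k a\<bar> * norm h)"
    using k by (intro infsum_mono abs_summable summable_on_cmult_left)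
      (simp_all add: mult_left_mono norm_bounded)
  also have "\<dots> = (\<Sum>\<^sub>\<infinity>a\<in>A. \<bar>k a\<bar>) * norm h"
    by (rule infsum_cmult_left')
  finally show ?thesis .
qed

lemma
  fixes h :: "'a::topological_space \<Rightarrow>\<^sub>C 'b::banach"
  assumes k: "k abs_summable_on UNIV"
  shows has_sum_sum_op: "((\<lambda>a. k a *\<^sub>R h a) has_sum sum_op k h) UNIV"
    and norm_sum_op_le: "norm (sum_op k :: ('a \<Rightarrow>\<^sub>C 'b) \<Rightarrow>\<^sub>L 'b) \<le> (\<Sum>\<^sub>\<infinity>a. \<bar>k a\<bar>)"
proof -
  define S where "S h = (\<Sum>\<^sub>\<infinity>a. k a *\<^sub>R apply_bcontfun h a)" for h :: "'a \<Rightarrow>\<^sub>C 'b"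
  note summable = abs_summable_summable [OF abs_summable_on_scaleR_bcontfun [OF k]]
  have norm_S: "norm (S h) \<le> (\<Sum>\<^sub>\<infinity>a. \<bar>k a\<bar>) * norm h" for h
    unfolding S_def by (rule norm_infsum_scaleR_bcontfun_le [OF k])
  have "bounded_linear S"
  proof (rule bounded_linear_intro)
    show "S (g + h) = S g + S h" for g h
      by (simp add: S_def scaleR_add_right infsum_add [OF summable summable])
    show "S (r *\<^sub>R h) = r *\<^sub>R S h" for r h
      by (simp add: S_def infsum_scaleR_right [symmetric] mult.commute)
    show "norm (S h) \<le> norm h * (\<Sum>\<^sub>\<infinity>a. \<bar>k a\<bar>)" for h
      using norm_S by (simp add: mult.commute)
  qed
  then have sum_op_eq: "sum_op k h = S h" for h
    by (simp add: sum_op_def bounded_linear_Blinfun_apply flip: S_def)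
  show "((\<lambda>a. k a *\<^sub>R h a) has_sum sum_op k h) UNIV"
    by (simp add: sum_op_eq S_def summable)
  show "norm (sum_op k :: ('a \<Rightarrow>\<^sub>C 'b) \<Rightarrow>\<^sub>L 'b) \<le> (\<Sum>\<^sub>\<infinity>a. \<bar>k a\<bar>)"
    by (rule norm_blinfun_bound) (simp_all add: sum_op_eq norm_S infsum_nonneg)
qed

definition map_op ::
    "('a::real_normed_vector \<Rightarrow>\<^sub>L 'b::real_normed_vector) \<Rightarrow> (nat \<Rightarrow>\<^sub>C 'a) \<Rightarrow>\<^sub>L (nat \<Rightarrow>\<^sub>C 'b)" where
  "map_op T = seq_op (\<lambda>m. T o\<^sub>L eval_op m)"

lemma
  shows map_op_apply [simp]: "map_op T h m = T (h m)"
    and norm_map_op_le: "norm (map_op T) \<le> norm T"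
proof -
  have norm_compose_le: "norm (T o\<^sub>L eval_op m) \<le> norm T" for m :: nat
    using norm_blinfun_compose [of T "eval_op m"] norm_eval_op_le [of m]
    by (meson mult_left_le norm_ge_zero order_trans)
  show "map_op T h m = T (h m)"
    by (simp add: map_op_def seq_op_apply [OF norm_compose_le])
  show "norm (map_op T) \<le> norm T"
    unfolding map_op_def by (rule norm_seq_op_le [OF norm_compose_le])
qed

lemma map_op_compose: "map_op (S o\<^sub>L T) = map_op S o\<^sub>L map_op T"
  by (intro blinfun_eqI bcontfun_eqI) simp

lemma sum_op_map_op:
  assumes "k abs_summable_on UNIV"
  shows "sum_op k (map_op T h) = T (sum_op k h)"
proof -
  have "((\<lambda>a. k a *\<^sub>R T (h a)) has_sum T (sum_op k h)) UNIV"
    using has_sum_bounded_linear [OF blinfun.bounded_linear_right has_sum_sum_op [OF assms]]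
    by (simp add: blinfun.scaleR_right)
  then show ?thesis
    using has_sum_unique has_sum_sum_op [OF assms, of "map_op T h"] by simp
qed

section \<open>Representations of the free algebra by bounded operators\<close>

lemma blinfun_compose_assoc: "(a o\<^sub>L b) o\<^sub>L c = a o\<^sub>L (b o\<^sub>L c)"
  by (rule blinfun_eqI) simp

lemma id_blinfun_compose [simp]: "id_blinfun o\<^sub>L a = a" "a o\<^sub>L id_blinfun = a"
  by (auto intro: blinfun_eqI)

lemmas blinfun_compose_simps =
  bounded_bilinear.add_left [OF bounded_bilinear_blinfun_compose]
  bounded_bilinear.add_right [OF bounded_bilinear_blinfun_compose]
  bounded_bilinear.scaleR_left [OF bounded_bilinear_blinfun_compose]
  bounded_bilinear.scaleR_right [OF bounded_bilinear_blinfun_compose]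

fun rep_word :: "(letter \<Rightarrow> 'a \<Rightarrow>\<^sub>L 'a) \<Rightarrow> letter list \<Rightarrow> 'a::real_normed_vector \<Rightarrow>\<^sub>L 'a" where
  "rep_word e [] = id_blinfun"
| "rep_word e (l # v) = e l o\<^sub>L rep_word e v"

definition rep_poly :: "(letter \<Rightarrow> 'a \<Rightarrow>\<^sub>L 'a) \<Rightarrow> nc_poly \<Rightarrow> 'a::real_normed_vector \<Rightarrow>\<^sub>L 'a" where
  "rep_poly e p =
    (\<Sum>v\<in>Poly_Mapping.keys p. of_rat (Poly_Mapping.lookup p v) *\<^sub>R rep_word e (letters v))"

definition rep_term ::
    "(letter \<Rightarrow> 'a \<Rightarrow>\<^sub>L 'a) \<Rightarrow> real \<Rightarrow> nc_poly fps \<Rightarrow> nat \<Rightarrow> 'a::real_normed_vector \<Rightarrow>\<^sub>L 'a" where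
  "rep_term e t w n = t ^ n *\<^sub>R rep_poly e (fps_nth w n)"

definition rep_fps :: "(letter \<Rightarrow> 'a \<Rightarrow>\<^sub>L 'a) \<Rightarrow> real \<Rightarrow> nc_poly fps \<Rightarrow> 'a::banach \<Rightarrow>\<^sub>L 'a" where
  "rep_fps e t w = suminf (rep_term e t w)"

lemma rep_word_append: "rep_word e (u @ v) = rep_word e u o\<^sub>L rep_word e v"
  by (induction u) (simp_all add: blinfun_compose_assoc)

lemma rep_poly_0 [simp]: "rep_poly e 0 = 0"
  by (simp add: rep_poly_def)

lemma rep_poly_single: "rep_poly e (Poly_Mapping.single v c) = of_rat c *\<^sub>R rep_word e (letters v)"
  by (simp add: rep_poly_def)

lemma letters_0 [simp]: "letters 0 = []"
  by (simp add: zero_word_def)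

lemma rep_poly_1 [simp]: "rep_poly e 1 = id_blinfun"
  using rep_poly_single [of e 0 1] by simp

lemma rep_poly_add: "rep_poly e (p + r) = rep_poly e p + rep_poly e r"
  unfolding rep_poly_def
  by (rule setsum_keys_plus_distrib) (simp_all add: of_rat_add scaleR_add_left)

lemma rep_poly_uminus: "rep_poly e (- p) = - rep_poly e p"
  using rep_poly_add [of e p "- p"] by (simp add: eq_neg_iff_add_eq_0 add.commute)

lemma rep_poly_sum: "rep_poly e (sum p I) = (\<Sum>i\<in>I. rep_poly e (p i))"
  by (induction I rule: infinite_finite_induct) (simp_all add: rep_poly_add)

lemma rep_poly_mult: "rep_poly e (p * r) = rep_poly e p o\<^sub>L rep_poly e r"
proof (induction p rule: nc_poly_induct)
  case (single v c)
  show ?case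
  proof (induction r rule: nc_poly_induct)
    case (single w d)
    show ?case
      by (simp add: mult_single rep_poly_single plus_word_def rep_word_append of_rat_mult
          blinfun_compose_simps)
  next
    case (add p r)
    then show ?case by (simp add: distrib_left rep_poly_add blinfun_compose_simps)
  qed simp
next
  case (add p r)
  then show ?case by (simp add: distrib_right rep_poly_add blinfun_compose_simps)
qed simp

lemma norm_rep_poly_power_le: "norm (rep_poly e (p ^ n)) \<le> norm (rep_poly e p) ^ n"
proof (induction n)
  case 0
  show ?case by (simp add: norm_blinfun_id_le)
next
  case (Suc n)
  have "norm (rep_poly e (p ^ Suc n)) \<le> norm (rep_poly e p) * norm (rep_poly e (p ^ n))"
    by (simp add: rep_poly_mult norm_blinfun_compose)
  also have "\<dots> \<le> norm (rep_poly e p) * norm (rep_poly e p) ^ n"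
    by (rule mult_left_mono [OF Suc]) simp
  finally show ?case by simp
qed

lemma rep_term_add: "rep_term e t (f + g) n = rep_term e t f n + rep_term e t g n"
  by (simp add: rep_term_def rep_poly_add scaleR_add_right)

lemma rep_term_mult:
  "rep_term e t (f * g) n = (\<Sum>i\<le>n. rep_term e t f i o\<^sub>L rep_term e t g (n - i))"
proof -
  have "t ^ n *\<^sub>R (rep_poly e (fps_nth f i) o\<^sub>L rep_poly e (fps_nth g (n - i))) =
      rep_term e t f i o\<^sub>L rep_term e t g (n - i)" if "i \<le> n" for i
    using that by (simp add: rep_term_def blinfun_compose_simps flip: power_add)
  then show ?thesis
    by (simp add: rep_term_def fps_mult_nth rep_poly_sum rep_poly_mult scaleR_sum_right
        atMost_atLeast0)
qed

lemma rep_term_fps_const: "rep_term e t (fps_const p) n = (if n = 0 then rep_poly e p else 0)"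
  by (simp add: rep_term_def)

lemma summable_rep_term_fps_const: "summable (\<lambda>n. norm (rep_term e t (fps_const p) n))"
  by (rule summable_finite [of "{0}"]) (auto simp: rep_term_fps_const)

lemma rep_term_fps_X: "rep_term e t fps_X n = (if n = 1 then t *\<^sub>R id_blinfun else 0)"
  by (simp add: rep_term_def)

lemma inv_yx_nth: "fps_nth inv_yx n = (- monomial [Y, X]) ^ n"
proof (induction n)
  case 0
  have "fps_nth (one_yx * inv_yx) 0 = 1" by (simp add: inv_yx_right)
  then show ?case by (simp add: one_yx_def)
next
  case (Suc n)
  have yx: "gen_y * gen_x = fps_const (monomial [Y, X])"
    by (simp add: gen_x_def gen_y_def mult_single plus_word_def)
  have "one_yx * inv_yx = inv_yx + fps_const (monomial [Y, X]) * (inv_yx * fps_X)"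
    by (simp add: one_yx_def yx distrib_right mult.assoc fps_X_central)
  then have "fps_nth inv_yx (Suc n) + monomial [Y, X] * fps_nth inv_yx n = 0"
    using arg_cong [OF inv_yx_right, of "\<lambda>f. fps_nth f (Suc n)"] by simp
  then show ?case
    by (simp add: Suc eq_neg_iff_add_eq_0)
qed

lemma one_in_A: "1 \<in> alg_A"
  using alg_A.scalar [of 1] by simp

locale yx_contraction =
  fixes e :: "letter \<Rightarrow> 'a \<Rightarrow>\<^sub>L 'a::banach" and t :: real
  assumes yx_contractive: "\<bar>t\<bar> * norm (e Y o\<^sub>L e X) < 1"
begin

lemma summable_rep_term_inv_yx: "summable (\<lambda>n. norm (rep_term e t inv_yx n))"
proof (rule summable_comparison_test' [OF summable_geometric])
  show "norm (\<bar>t\<bar> * norm (e Y o\<^sub>L e X)) < 1"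
    using yx_contractive by simp
  have "norm (rep_poly e (- monomial [Y, X])) = norm (e Y o\<^sub>L e X)"
    by (simp add: rep_poly_uminus rep_poly_single)
  then show "norm (norm (rep_term e t inv_yx n)) \<le> (\<bar>t\<bar> * norm (e Y o\<^sub>L e X)) ^ n" for n
    using norm_rep_poly_power_le [of e "- monomial [Y, X]" n]
    by (simp add: rep_term_def inv_yx_nth power_mult_distrib power_abs mult_left_mono)
qed

lemma summable_rep_term:
  assumes "w \<in> alg_A"
  shows "summable (\<lambda>n. norm (rep_term e t w n))"
  using assms
proof (induction rule: alg_A.induct)
  case (add f g)
  show ?case
    by (rule summable_comparison_test' [OF summable_add [OF add.IH]])
      (simp add: rep_term_add norm_triangle_ineq)
next
  case (mult f g)
  have "norm (rep_term e t (f * g) n) \<le>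
      (\<Sum>i\<le>n. norm (rep_term e t f i) * norm (rep_term e t g (n - i)))" for n
    unfolding rep_term_mult by (intro sum_norm_le norm_blinfun_compose)
  moreover have "summable (\<lambda>n. \<Sum>i\<le>n. norm (rep_term e t f i) * norm (rep_term e t g (n - i)))"
    by (rule summable_Cauchy_product) (use mult.IH in simp_all)
  ultimately show ?case
    by (intro summable_comparison_test' [of _ 0 "\<lambda>n. norm (rep_term e t (f * g) n)"]) auto
next
  case lam
  show ?case
    by (rule summable_finite [of "{1}"]) (auto simp: rep_term_fps_X)
qed (simp_all add: scalar_def gen_x_def gen_y_def summable_rep_term_fps_const
    summable_rep_term_inv_yx)

lemma rep_term_sums: "w \<in> alg_A \<Longrightarrow> rep_term e t w sums rep_fps e t w"
  unfolding rep_fps_def by (rule summable_sums [OF summable_norm_cancel [OF summable_rep_term]])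

lemma rep_term_apply_sums: "w \<in> alg_A \<Longrightarrow> (\<lambda>n. rep_term e t w n h) sums rep_fps e t w h"
  by (intro bounded_linear.sums [OF blinfun.bounded_linear_left] rep_term_sums)

lemma summable_blinfun_rep_term:
  fixes T :: "'a \<Rightarrow>\<^sub>L 'b::real_normed_vector"
  assumes "w \<in> alg_A"
  shows "summable (\<lambda>n. norm (T (rep_term e t w n h)))"
proof (rule summable_comparison_test')
  show "summable (\<lambda>n. norm T * (norm (rep_term e t w n) * norm h))"
    by (rule summable_mult [OF summable_mult2 [OF summable_rep_term [OF assms]]])
  show "norm (norm (T (rep_term e t w n h))) \<le> norm T * (norm (rep_term e t w n) * norm h)" for n
    using order_trans [OF norm_blinfun mult_left_mono [OF norm_blinfun]] by simp
qed

lemma rep_fps_add: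
  assumes "f \<in> alg_A" and "g \<in> alg_A"
  shows "rep_fps e t (f + g) = rep_fps e t f + rep_fps e t g"
  using sums_add [OF assms [THEN rep_term_sums]]
  unfolding rep_fps_def by (intro sums_unique [symmetric]) (simp add: rep_term_add [abs_def])

lemma rep_fps_mult:
  assumes "f \<in> alg_A" and "g \<in> alg_A"
  shows "rep_fps e t (f * g) = rep_fps e t f o\<^sub>L rep_fps e t g"
  using Cauchy_product_bilinear_sums [OF bounded_bilinear_blinfun_compose
      assms [THEN summable_rep_term]]
  unfolding rep_fps_def by (intro sums_unique [symmetric]) (simp add: rep_term_mult [abs_def])

lemma rep_fps_const: "rep_fps e t (fps_const p) = rep_poly e p"
  using sums_single [of 0 "\<lambda>_. rep_poly e p"]
  by (simp add: rep_fps_def rep_term_fps_const [abs_def] sums_iff)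

lemma rep_fps_lambda: "rep_fps e t fps_X = t *\<^sub>R id_blinfun"
  using sums_single [of 1 "\<lambda>_. t *\<^sub>R id_blinfun"]
  by (simp add: rep_fps_def rep_term_fps_X [abs_def] sums_iff)

lemma rep_fps_scalar: "rep_fps e t (scalar c) = of_rat c *\<^sub>R id_blinfun"
  by (simp add: scalar_def rep_fps_const rep_poly_single)

lemma rep_fps_gen_x: "rep_fps e t gen_x = e X"
  and rep_fps_gen_y: "rep_fps e t gen_y = e Y"
  by (simp_all add: gen_x_def gen_y_def rep_fps_const rep_poly_single)

lemma rep_fps_one_yx: "rep_fps e t one_yx h = h + t *\<^sub>R e Y (e X h)"
proof -
  have "rep_fps e t 1 = id_blinfun"
    using rep_fps_scalar [of 1] by simp
  then show ?thesis
    by (simp add: one_yx_def rep_fps_add rep_fps_mult alg_A.intros one_in_A rep_fps_gen_x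
        rep_fps_gen_y rep_fps_lambda blinfun.bilinear_simps)
qed

lemma rep_fps_inv_yx: "rep_fps e t inv_yx (h + t *\<^sub>R e Y (e X h)) = h"
proof -
  have "rep_fps e t inv_yx o\<^sub>L rep_fps e t one_yx = rep_fps e t 1"
    by (simp add: alg_A.inv one_yx_in_A inv_yx_left flip: rep_fps_mult)
  also have "\<dots> = id_blinfun"
    using rep_fps_scalar [of 1] by simp
  finally have "(rep_fps e t inv_yx o\<^sub>L rep_fps e t one_yx) h = h"
    by simp
  then show ?thesis
    by (simp add: rep_fps_one_yx)
qed

end

lemma yx_contraction_map_op:
  assumes "yx_contraction e t"
  shows "yx_contraction (\<lambda>l. map_op (e l)) t"
proof
  interpret yx_contraction e t by fact
  have "\<bar>t\<bar> * norm (map_op (e Y) o\<^sub>L map_op (e X)) \<le> \<bar>t\<bar> * norm (e Y o\<^sub>L e X)"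
    by (simp add: mult_left_mono norm_map_op_le flip: map_op_compose)
  also have "\<dots> < 1" by (rule yx_contractive)
  finally show "\<bar>t\<bar> * norm (map_op (e Y) o\<^sub>L map_op (e X)) < 1" .
qed

lemma rep_word_intertwine:
  fixes e :: "letter \<Rightarrow> 'a \<Rightarrow>\<^sub>L 'a::real_normed_vector"
    and d :: "letter \<Rightarrow> 'b \<Rightarrow>\<^sub>L 'b::real_normed_vector" and T :: "'a \<Rightarrow>\<^sub>L 'b"
  assumes "\<And>l h. T (e l h) = d l (T h)"
  shows "T (rep_word e v h) = rep_word d v (T h)"
  by (induction v arbitrary: h) (simp_all add: assms)

lemma rep_poly_intertwine:
  fixes e :: "letter \<Rightarrow> 'a \<Rightarrow>\<^sub>L 'a::real_normed_vector"
    and d :: "letter \<Rightarrow> 'b \<Rightarrow>\<^sub>L 'b::real_normed_vector" and T :: "'a \<Rightarrow>\<^sub>L 'b"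
  assumes "\<And>l h. T (e l h) = d l (T h)"
  shows "T (rep_poly e p h) = rep_poly d p (T h)"
  by (induction p rule: nc_poly_induct)
    (simp_all add: rep_poly_single rep_poly_add rep_word_intertwine [of T, OF assms]
      blinfun.bilinear_simps)

lemma rep_fps_intertwine:
  fixes T :: "'a::banach \<Rightarrow>\<^sub>L 'b::banach"
  assumes e: "yx_contraction e t" and d: "yx_contraction d t" and w: "w \<in> alg_A"
    and T: "\<And>l h. T (e l h) = d l (T h)"
  shows "T (rep_fps e t w h) = rep_fps d t w (T h)"
proof -
  have "T (rep_term e t w n h) = rep_term d t w n (T h)" for n
    by (simp add: rep_term_def blinfun.bilinear_simps rep_poly_intertwine [of T, OF T])
  moreover have "(\<lambda>n. T (rep_term e t w n h)) sums T (rep_fps e t w h)"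
    by (intro bounded_linear.sums [OF blinfun.bounded_linear_right]
        yx_contraction.rep_term_apply_sums e w)
  ultimately show ?thesis
    using yx_contraction.rep_term_apply_sums [OF d w, of "T h"] by (simp add: sums_unique2)
qed

section \<open>Transport of the algebra through a common vector\<close>

locale tau_transport =
  left: yx_contraction e t + right: yx_contraction d t
  for e d :: "letter \<Rightarrow> 'a \<Rightarrow>\<^sub>L 'a::banach" and t :: real +
  fixes h :: 'a
  assumes commute: "e k (d l g) = d l (e k g)"
    and transport_yx: "e Y (e X h) = d Y (d X h)"
    and transport_y: "e Y h = d X (h + t *\<^sub>R d Y (d X h))"
    and transport_y': "d Y h = e X (h + t *\<^sub>R e Y (e X h))"
begin

lemma rep_fps_commute:
  assumes f: "f \<in> alg_A" and g: "g \<in> alg_A"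
  shows "rep_fps e t f (rep_fps d t g v) = rep_fps d t g (rep_fps e t f v)"
proof -
  have contraction: "yx_contraction e t" "yx_contraction d t"
    by unfold_locales
  have "d l (rep_fps e t f v) = rep_fps e t f (d l v)" for l v
    by (rule rep_fps_intertwine [OF contraction(1,1) f]) (simp add: commute)
  then show ?thesis
    by (intro rep_fps_intertwine [OF contraction(2,2) g]) simp
qed

lemma transport_gen_x: "rep_fps e t gen_x h = rep_fps d t (tau gen_x) h"
proof -
  have "d Y h = e X (h + t *\<^sub>R d Y (d X h))"
    by (simp only: transport_y' transport_yx)
  also have "\<dots> = e X h + t *\<^sub>R d Y (d X (e X h))"
    by (simp add: blinfun.bilinear_simps commute)
  finally have "rep_fps d t inv_yx (d Y h) = e X h"
    by (simp add: right.rep_fps_inv_yx)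
  then show ?thesis
    by (simp add: tau_x right.rep_fps_mult alg_A.intros left.rep_fps_gen_x right.rep_fps_gen_y)
qed

lemma transport_gen_y: "rep_fps e t gen_y h = rep_fps d t (tau gen_y) h"
  by (simp add: tau_y right.rep_fps_mult alg_A.intros one_yx_in_A left.rep_fps_gen_y
      right.rep_fps_gen_x right.rep_fps_one_yx transport_y)

lemma transport_inv_yx: "rep_fps e t inv_yx h = rep_fps d t (tau inv_yx) h"
proof -
  let ?D = "h + t *\<^sub>R e Y (e X h)"
  have "rep_fps e t inv_yx h = rep_fps e t inv_yx (rep_fps d t inv_yx ?D)"
    using right.rep_fps_inv_yx [of h] by (simp add: transport_yx)
  also have "\<dots> = rep_fps d t inv_yx (rep_fps e t inv_yx ?D)"
    by (simp add: rep_fps_commute alg_A.inv)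
  finally show ?thesis
    by (simp add: left.rep_fps_inv_yx tau_inv_yx)
qed

theorem rep_fps_eq_rep_fps_tau:
  assumes "w \<in> alg_A"
  shows "rep_fps e t w h = rep_fps d t (tau w) h"
  using assms
proof (induction rule: alg_A.induct)
  case (add f g)
  then show ?case
    by (simp add: tau_add left.rep_fps_add right.rep_fps_add tau_in_A blinfun.add_left)
next
  case (mult f g)
  have "rep_fps e t (f * g) h = rep_fps e t f (rep_fps d t (tau g) h)"
    by (simp add: left.rep_fps_mult mult.hyps mult.IH)
  also have "\<dots> = rep_fps d t (tau g) (rep_fps d t (tau f) h)"
    by (simp add: rep_fps_commute mult.hyps tau_in_A mult.IH)
  finally show ?case
    by (simp add: tau_mult right.rep_fps_mult tau_in_A mult.hyps)
qed (simp_all add: tau_scalar tau_lambda left.rep_fps_scalar right.rep_fps_scalar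
    left.rep_fps_lambda right.rep_fps_lambda transport_gen_x transport_gen_y transport_inv_yx)

end

section \<open>The connected sum\<close>

locale connected_sum =
  fixes q \<xi> \<eta> :: real
  assumes q: "0 < q" "q < 1"
    and \<xi>: "0 \<le> \<xi>" "\<xi> < (1 - q) / 2"
    and \<eta>: "0 \<le> \<eta>" "\<eta> < (1 - q) / 2"
begin

definition weight_x :: "nat \<Rightarrow> real" where
  "weight_x m = q ^ m / qbracket q m"

definition weight_y :: "nat \<Rightarrow> real" where
  "weight_y m = qbracket q m / ((qbracket q m - q ^ m * \<xi>) * (qbracket q m - q ^ m * \<eta>))"

text \<open>Division by zero makes \<open>weight_x 0\<close> vanish; its reciprocal then has the correct value
  \<open>[0] / q\<^sup>0 = 0\<close>.\<close>

lemma weight_0 [simp]: "weight_x 0 = 0" "weight_y 0 = 0"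
  by (simp_all add: weight_x_def weight_y_def qbracket_def)

lemma qbracket_ge_1:
  assumes "0 < m"
  shows "1 \<le> qbracket q m"
proof -
  have "q ^ m \<le> q ^ 1"
    using assms q by (intro power_decreasing) auto
  then show ?thesis
    using q by (simp add: qbracket_def)
qed

lemma qbracket_diff_ge:
  assumes "0 < m" and "0 \<le> c" and "c < (1 - q) / 2"
  shows "qbracket q m / 2 \<le> qbracket q m - q ^ m * c"
proof -
  have "q ^ m * c \<le> 1 * (1 / 2)"
    using assms q by (intro mult_mono power_le_one) auto
  then show ?thesis
    using qbracket_ge_1 [OF assms(1)] by simp
qed

lemma weight_x_pos: "0 < m \<Longrightarrow> 0 < weight_x m"
  using qbracket_ge_1 [of m] q by (simp add: weight_x_def)

lemma weight_x_nonneg: "0 \<le> weight_x m"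
  using weight_x_pos [of m] by (cases "m = 0") auto

lemma weight_x_le: "weight_x m \<le> q ^ m"
proof (cases "m = 0")
  case False
  then have "q ^ m * 1 \<le> q ^ m * qbracket q m"
    using q qbracket_ge_1 [of m] by (intro mult_left_mono) auto
  with False show ?thesis
    using qbracket_ge_1 [of m] by (simp add: weight_x_def divide_le_eq)
qed simp

lemma weight_x_le_1: "weight_x m \<le> 1"
  using weight_x_le [of m] q power_le_one [of q m] by simp

lemma weight_y_nonneg: "0 \<le> weight_y m"
proof (cases "m = 0")
  case False
  then show ?thesis
    using qbracket_ge_1 [of m] qbracket_diff_ge [OF _ \<xi>, of m] qbracket_diff_ge [OF _ \<eta>, of m]
    by (simp add: weight_y_def)
qed simp

lemma weight_y_le: "weight_y m \<le> 4"
proof (cases "m = 0")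
  case False
  then have "0 < m" by simp
  note bounds = qbracket_ge_1 [OF this] qbracket_diff_ge [OF this \<xi>] qbracket_diff_ge [OF this \<eta>]
  have "qbracket q m / 2 * (1 / 2) \<le> (qbracket q m - q ^ m * \<xi>) * (qbracket q m - q ^ m * \<eta>)"
    using bounds by (intro mult_mono) auto
  moreover have "0 < (qbracket q m - q ^ m * \<xi>) * (qbracket q m - q ^ m * \<eta>)"
    using bounds by (intro mult_pos_pos) auto
  ultimately show ?thesis
    by (simp add: weight_y_def divide_le_eq)
qed simp

abbreviation weight_yx :: "nat \<Rightarrow> real" where
  "weight_yx m \<equiv> weight_y m * weight_x m"

definition \<alpha> :: real where "\<alpha> = 1 + (1 - q) * \<xi>"
definition \<beta> :: real where "\<beta> = 1 + (1 - q) * \<eta>"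

lemma qbracket_diff_eq:
  "qbracket q m - q ^ m * \<xi> = (1 - \<alpha> * q ^ m) / (1 - q)"
  "qbracket q m - q ^ m * \<eta> = (1 - \<beta> * q ^ m) / (1 - q)"
  using q by (simp_all add: qbracket_def \<alpha>_def \<beta>_def field_simps)

lemma weight_eq:
  "weight_x m = (1 - q) * q ^ m / (1 - q ^ m)"
  "weight_y m = (1 - q) * (1 - q ^ m) / ((1 - \<alpha> * q ^ m) * (1 - \<beta> * q ^ m))"
  unfolding weight_x_def weight_y_def qbracket_diff_eq using q by (simp_all add: qbracket_def)

lemma one_minus_power_pos:
  assumes "0 < m"
  shows "0 < 1 - q ^ m" "0 < 1 - \<alpha> * q ^ m" "0 < 1 - \<beta> * q ^ m"
proof -
  have "0 < qbracket q m" "0 < qbracket q m - q ^ m * \<xi>" "0 < qbracket q m - q ^ m * \<eta>"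
    using qbracket_ge_1 [OF assms] qbracket_diff_ge [OF assms \<xi>] qbracket_diff_ge [OF assms \<eta>]
    by linarith+
  then show "0 < 1 - q ^ m" "0 < 1 - \<alpha> * q ^ m" "0 < 1 - \<beta> * q ^ m"
    unfolding qbracket_diff_eq using q by (simp_all add: qbracket_def zero_less_divide_iff)
qed

lemma one_minus_alpha_beta_power_pos:
  assumes "0 < m"
  shows "0 < 1 - \<alpha> * \<beta> * q ^ m"
proof -
  define p where "p = 1 - q"
  have p: "0 < p" "p < 1" "q = 1 - p"
    using q by (simp_all add: p_def)
  have "p * c \<le> p / 2" if "c < p / 2" "0 \<le> c" for c
    using that p mult_left_le_one_le [of c p] by linarith
  then have alpha_beta_le: "\<alpha> \<le> 1 + p / 2" "\<beta> \<le> 1 + p / 2"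
    using \<xi> \<eta> by (simp_all add: \<alpha>_def \<beta>_def flip: p_def)
  have nonneg: "0 \<le> \<alpha>" "0 \<le> \<beta>"
    using q \<xi> \<eta> by (simp_all add: \<alpha>_def \<beta>_def)
  have "q ^ m \<le> q ^ 1"
    using assms q by (intro power_decreasing) auto
  then have "\<alpha> * \<beta> * q ^ m \<le> (1 + p / 2) * (1 + p / 2) * q"
    using alpha_beta_le nonneg q by (intro mult_mono) auto
  also have "\<dots> = 1 - 3 / 4 * p\<^sup>2 - p ^ 3 / 4"
    by (simp add: p(3) power2_eq_square power3_eq_cube field_simps)
  also have "\<dots> < 1"
    using zero_less_power [OF p(1), of 2] zero_less_power [OF p(1), of 3] by linarith
  finally show ?thesis by simp
qed

lemma weight_ratio:
  assumes "0 < m"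
  shows "1 - \<xi> * \<eta> * weight_yx m + weight_y m / weight_x n =
    (1 - q ^ m) * (1 - \<alpha> * \<beta> * q ^ (m + n)) / (q ^ n * ((1 - \<alpha> * q ^ m) * (1 - \<beta> * q ^ m)))"
proof -
  define u where "u = q ^ m"
  define v where "v = q ^ n"
  define S where "S = (1 - \<alpha> * u) * (1 - \<beta> * u)"
  have nz: "v \<noteq> 0" "S \<noteq> 0" "1 - u \<noteq> 0" "1 - q \<noteq> 0"
    using one_minus_power_pos [OF assms] q by (simp_all add: u_def v_def S_def)
  have "weight_yx m = (1 - q)\<^sup>2 * u / S"
    using nz by (simp add: weight_eq S_def flip: u_def) (simp add: power2_eq_square)
  then have "\<xi> * \<eta> * weight_yx m = (\<alpha> - 1) * (\<beta> - 1) * u / S"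
    by (simp add: \<alpha>_def \<beta>_def power2_eq_square)
  moreover have "weight_y m / weight_x n = (1 - u) * (1 - v) / (v * S)"
    using nz by (simp add: weight_eq S_def flip: u_def v_def)
  ultimately have "1 - \<xi> * \<eta> * weight_yx m + weight_y m / weight_x n =
      1 - (\<alpha> - 1) * (\<beta> - 1) * u / S + (1 - u) * (1 - v) / (v * S)"
    by simp
  also have "\<dots> = (v * S - (\<alpha> - 1) * (\<beta> - 1) * u * v + (1 - u) * (1 - v)) / (v * S)"
    using nz by (simp add: field_simps)
  also have "v * S - (\<alpha> - 1) * (\<beta> - 1) * u * v + (1 - u) * (1 - v) =
      (1 - u) * (1 - \<alpha> * \<beta> * (u * v))"
    by (simp add: S_def algebra_simps)
  finally show ?thesis
    by (simp add: u_def v_def S_def power_add)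
qed

definition conn_num :: "nat \<Rightarrow> real" where
  "conn_num m = qprod q \<alpha> m * qprod q \<beta> m / qprod q 1 m"

definition conn_den :: "nat \<Rightarrow> real" where
  "conn_den m = qprod q (\<alpha> * \<beta>) m"

definition conn :: "nat \<Rightarrow> nat \<Rightarrow> real" where
  "conn m n =
    lim conn_den / lim conn_num * q ^ (m * n) * conn_num m * conn_num n / conn_den (m + n)"

lemma conn_num_Suc:
  "conn_num (Suc m) =
    conn_num m * ((1 - \<alpha> * q ^ Suc m) * (1 - \<beta> * q ^ Suc m) / (1 - q ^ Suc m))"
  by (simp add: conn_num_def qprod_Suc)

lemma conn_den_Suc: "conn_den (Suc m) = conn_den m * (1 - \<alpha> * \<beta> * q ^ Suc m)"
  by (simp add: conn_den_def qprod_Suc)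

lemma conn_num_den_limits:
  "lim conn_num \<noteq> 0" "conn_num \<longlonglongrightarrow> lim conn_num"
  "lim conn_den \<noteq> 0" "conn_den \<longlonglongrightarrow> lim conn_den"
proof -
  have nz: "1 * q ^ Suc n \<noteq> 1" "\<alpha> * q ^ Suc n \<noteq> 1" "\<beta> * q ^ Suc n \<noteq> 1"
    "\<alpha> * \<beta> * q ^ Suc n \<noteq> 1" for n
    using one_minus_power_pos [of "Suc n"] one_minus_alpha_beta_power_pos [of "Suc n"] by auto
  have "\<bar>q\<bar> < 1" using q by simp
  note tendsto = qprod_tendsto_nonzero [OF this]
  obtain a b c d where nonzero: "a \<noteq> 0" "b \<noteq> 0" "c \<noteq> 0" "d \<noteq> 0"
    and lim: "qprod q \<alpha> \<longlonglongrightarrow> a" "qprod q \<beta> \<longlonglongrightarrow> b" "qprod q 1 \<longlonglongrightarrow> c"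
      "qprod q (\<alpha> * \<beta>) \<longlonglongrightarrow> d"
    using tendsto [OF nz(1)] tendsto [OF nz(2)] tendsto [OF nz(3)] tendsto [OF nz(4)] by metis
  have "conn_num \<longlonglongrightarrow> a * b / c"
    unfolding conn_num_def using lim \<open>c \<noteq> 0\<close> by (intro tendsto_intros) auto
  moreover have "conn_den \<longlonglongrightarrow> d"
    unfolding conn_den_def by (rule lim)
  ultimately show "lim conn_num \<noteq> 0" "conn_num \<longlonglongrightarrow> lim conn_num"
      "lim conn_den \<noteq> 0" "conn_den \<longlonglongrightarrow> lim conn_den"
    using nonzero by (simp_all add: limI)
qed

lemma conn_commute: "conn m n = conn n m"
  by (simp add: conn_def mult.commute add.commute)

lemma conn_bound:
  obtains B where "0 \<le> B" and "\<And>m n. \<bar>conn m n\<bar> \<le> B * q ^ (m * n)"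
proof -
  define K where "K = \<bar>lim conn_den / lim conn_num\<bar>"
  have "(\<lambda>n. 1 / conn_den n) \<longlonglongrightarrow> 1 / lim conn_den"
    by (intro tendsto_intros conn_num_den_limits)
  then have "Bseq (\<lambda>n. 1 / conn_den n)" and "Bseq conn_num"
    using conn_num_den_limits by (auto intro: convergent_imp_Bseq convergentI)
  then obtain A C where A: "0 < A" "\<And>n. \<bar>conn_num n\<bar> \<le> A"
    and C: "0 < C" "\<And>n. \<bar>1 / conn_den n\<bar> \<le> C"
    unfolding Bseq_def by (metis real_norm_def)
  have "\<bar>conn m n\<bar> \<le> K * A * A * C * q ^ (m * n)" for m n
  proof -
    have "\<bar>conn m n\<bar> = K * \<bar>conn_num m\<bar> * \<bar>conn_num n\<bar> * \<bar>1 / conn_den (m + n)\<bar> * q ^ (m * n)"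
      using q by (simp add: conn_def K_def abs_mult)
    also have "\<dots> \<le> K * A * A * C * q ^ (m * n)"
      using A C q by (intro mult_mono) (auto simp: K_def)
    finally show ?thesis .
  qed
  moreover have "0 \<le> K * A * A * C"
    using A C by (simp add: K_def)
  ultimately show ?thesis by (rule that [rotated])
qed

lemma conn_bound_right:
  obtains B where "\<And>m. \<bar>conn m n\<bar> \<le> B" and "\<And>m. 0 < n \<Longrightarrow> \<bar>conn m n\<bar> \<le> B * q ^ m"
proof -
  obtain B where "0 \<le> B" and B: "\<And>m. \<bar>conn m n\<bar> \<le> B * q ^ (m * n)"
    using conn_bound by metis
  have "\<bar>conn m n\<bar> \<le> B" for m
    using B [of m] \<open>0 \<le> B\<close> q power_le_one [of q "m * n"] mult_left_le [of "q ^ (m * n)" B] by simp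
  moreover have "\<bar>conn m n\<bar> \<le> B * q ^ m" if "0 < n" for m
  proof -
    have "q ^ (m * n) \<le> q ^ m" using that q by (intro power_decreasing) auto
    then show ?thesis
      using B [of m] \<open>0 \<le> B\<close> mult_left_mono order_trans by blast
  qed
  ultimately show ?thesis using that by blast
qed

lemma conn_tendsto_0:
  assumes "0 < n"
  shows "(\<lambda>m. conn m n) \<longlonglongrightarrow> 0"
proof -
  obtain B where B: "\<And>m. \<bar>conn m n\<bar> \<le> B * q ^ m"
    using conn_bound_right assms by metis
  have "(\<lambda>m. B * q ^ m) \<longlonglongrightarrow> B * 0"
    using q by (intro tendsto_intros LIMSEQ_power_zero) auto
  then show ?thesis
    by (intro Lim_null_comparison [of "\<lambda>m. conn m n" "\<lambda>m. B * q ^ m"]) (simp_all add: B)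
qed

lemma conn_0_tendsto: "(\<lambda>m. conn m 0) \<longlonglongrightarrow> 1"
proof -
  have "(\<lambda>m. lim conn_den / lim conn_num * conn_num m / conn_den m) \<longlonglongrightarrow>
      lim conn_den / lim conn_num * lim conn_num / lim conn_den"
    by (intro tendsto_intros conn_num_den_limits)
  then show ?thesis
    using conn_num_den_limits by (simp add: conn_def conn_num_def)
qed

lemma conn_Suc:
  "conn m n = conn (Suc m) n *
    (1 - \<xi> * \<eta> * weight_yx (Suc m) + weight_y (Suc m) / weight_x n)"
proof -
  have cancel: "k * w * f * h / g =
      k * (v * w) * (f * (a * b / u)) * h / (g * d) * (u * d / (v * (a * b)))"
    if "v \<noteq> 0" "a \<noteq> 0" "b \<noteq> 0" "u \<noteq> 0" "d \<noteq> 0" for k w f h g v a b u d :: real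
    using that by simp
  show ?thesis
    unfolding weight_ratio [OF zero_less_Suc] conn_def conn_num_Suc add_Suc conn_den_Suc mult_Suc
      power_add [of q n]
    using q one_minus_power_pos [of "Suc m"] one_minus_alpha_beta_power_pos [of "Suc (m + n)"]
    by (intro cancel) simp_all
qed

text \<open>The right-hand side is symmetric in \<open>m\<close> and \<open>n\<close>; this is why \<open>Y X\<close> acts on the kernel in the
  same way through either variable.\<close>

lemma weight_yx_conn_diff:
  "weight_yx (Suc m) * (conn (Suc m) n - conn (Suc m) (Suc n)) =
    conn (Suc m) (Suc n) * (weight_y (Suc m) * weight_y (Suc n) -
      \<xi> * \<eta> * weight_yx (Suc m) * weight_yx (Suc n))"
proof -
  have "conn (Suc m) n = conn (Suc m) (Suc n) *
      (1 - \<xi> * \<eta> * weight_yx (Suc n) + weight_y (Suc n) / weight_x (Suc m))"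
    using conn_Suc [of n "Suc m"] by (simp add: conn_commute)
  then have "weight_x (Suc m) * (conn (Suc m) n - conn (Suc m) (Suc n)) = conn (Suc m) (Suc n) *
      (weight_y (Suc n) - \<xi> * \<eta> * weight_x (Suc m) * weight_yx (Suc n))"
    using weight_x_pos [of "Suc m"] by (simp add: field_simps)
  then show ?thesis
    by (simp add: mult.assoc) (simp add: algebra_simps)
qed

section \<open>Transport relations\<close>

lemma summable_weight_y_conn:
  assumes "0 < n"
  shows "(\<lambda>a. weight_y a * conn a n) summable_on A"
proof -
  obtain B where B: "\<And>a. \<bar>conn a n\<bar> \<le> B * q ^ a"
    using conn_bound_right assms by metis
  have "\<bar>weight_y a\<bar> * \<bar>conn a n\<bar> \<le> 4 * (B * q ^ a)" for a
    using B weight_y_nonneg weight_y_le by (intro mult_mono) auto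
  then show ?thesis
    using q by (intro summable_on_geometric_bound [where q = q and c = "4 * B"])
      (simp_all add: abs_mult mult.assoc)
qed

lemma summable_weight_yx_conn: "(\<lambda>a. weight_yx a * conn a n) summable_on A"
proof -
  obtain B where B: "\<And>a. \<bar>conn a n\<bar> \<le> B"
    using conn_bound_right by metis
  have "\<bar>weight_y a\<bar> * \<bar>weight_x a\<bar> * \<bar>conn a n\<bar> \<le> 4 * q ^ a * B" for a
    using B weight_y_nonneg weight_y_le weight_x_nonneg weight_x_le q by (intro mult_mono) auto
  then show ?thesis
    using q by (intro summable_on_geometric_bound [where q = q and c = "4 * B"])
      (simp_all add: abs_mult ac_simps)
qed

definition yx_tail :: "nat \<Rightarrow> nat \<Rightarrow> real" where
  "yx_tail m n = (\<Sum>\<^sub>\<infinity>a\<in>{m<..}. weight_yx a * conn a n)"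

lemma yx_tail_Suc:
  "yx_tail m n = weight_yx (Suc m) * conn (Suc m) n + yx_tail (Suc m) n"
  unfolding yx_tail_def by (rule infsum_greaterThan_Suc [OF summable_weight_yx_conn])

lemma yx_tail_tendsto_0: "(\<lambda>m. yx_tail m n) \<longlonglongrightarrow> 0"
  unfolding yx_tail_def by (rule infsum_greaterThan_tendsto_0 [OF summable_weight_yx_conn])

lemma yx_tail_Suc_right:
  "yx_tail m n = weight_yx (Suc n) * conn m (Suc n) + yx_tail m (Suc n)"
proof -
  define f where "f a = weight_yx a * conn a n - weight_yx a * conn a (Suc n)" for a
  define g where "g a = weight_yx (Suc n) * conn a (Suc n)" for a
  have g_diff: "g a - g (Suc a) = f (Suc a)" for a
    using weight_yx_conn_diff [of a n] weight_yx_conn_diff [of n a]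
    by (simp add: f_def g_def conn_commute [of _ "Suc n"] right_diff_distrib ac_simps)
  have has_sum_f: "(f has_sum yx_tail m n - yx_tail m (Suc n)) {m<..}"
    unfolding f_def yx_tail_def by (intro has_sum_diff has_sum_infsum summable_weight_yx_conn)
  have "g \<longlonglongrightarrow> weight_yx (Suc n) * 0"
    unfolding g_def by (intro tendsto_intros conn_tendsto_0) simp
  then have "infsum f {m<..} = g m"
    using infsum_greaterThan_telescope [OF has_sum_imp_summable [OF has_sum_f] g_diff, of 0] by simp
  then show ?thesis
    using infsumI [OF has_sum_f] by (simp add: g_def)
qed

lemma yx_tail_commute: "yx_tail m n = yx_tail n m"
proof -
  have const: "yx_tail m n - yx_tail n m = yx_tail m 0 - yx_tail 0 m" for n
  proof (induction n)
    case (Suc n)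
    then show ?case
      using yx_tail_Suc_right [of m n] yx_tail_Suc [of n m] by (simp add: conn_commute)
  qed simp
  show ?thesis
    using const [of n] const [of m] by simp
qed

lemma infsum_weight_y_conn:
  assumes "0 < n"
  shows "(\<Sum>\<^sub>\<infinity>a\<in>{m<..}. weight_y a * conn a n) = weight_x n * (conn m n + \<xi> * \<eta> * yx_tail m n)"
proof -
  define g where "g a = weight_x n * (conn a n + \<xi> * \<eta> * yx_tail a n)" for a
  have "g a - g (Suc a) = weight_y (Suc a) * conn (Suc a) n" for a
    using weight_x_pos [OF assms]
    by (simp add: g_def conn_Suc [of a n] yx_tail_Suc [of a n] field_simps)
  moreover have "g \<longlonglongrightarrow> weight_x n * (0 + \<xi> * \<eta> * 0)"
    unfolding g_def by (intro tendsto_intros conn_tendsto_0 [OF assms] yx_tail_tendsto_0)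
  ultimately have "(\<Sum>\<^sub>\<infinity>a\<in>{m<..}. weight_y a * conn a n) = g m"
    using infsum_greaterThan_telescope [OF summable_weight_y_conn [OF assms]] by fastforce
  then show ?thesis
    by (simp add: g_def)
qed

lemma conn_0_yx_tail: "conn m 0 + \<xi> * \<eta> * yx_tail m 0 = 1"
proof -
  define g where "g a = conn a 0 + \<xi> * \<eta> * yx_tail a 0" for a
  have "g a - g (Suc a) = 0" for a
    by (simp add: g_def conn_Suc [of a 0] yx_tail_Suc [of a 0] algebra_simps)
  moreover have "g \<longlonglongrightarrow> 1 + \<xi> * \<eta> * 0"
    unfolding g_def by (intro tendsto_intros conn_0_tendsto yx_tail_tendsto_0)
  ultimately have "(\<Sum>\<^sub>\<infinity>a\<in>{m<..}. 0) = g m - 1"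
    by (intro infsum_greaterThan_telescope) simp_all
  then show ?thesis
    by (simp add: g_def)
qed

lemma infsum_weight_y_conn_0:
  assumes "0 < n"
  shows "(\<Sum>\<^sub>\<infinity>a\<in>{0<..}. weight_y a * conn a n) = weight_x n"
  using infsum_weight_y_conn [OF assms, of 0] conn_0_yx_tail [of n]
  by (simp add: conn_commute [of 0] yx_tail_commute [of 0])

section \<open>The action on sequences\<close>

text \<open>A bounded sequence \<open>h\<close> encodes the function \<open>m \<mapsto> q\<^sup>m h(m)\<close>: on functions that are
  \<open>O(q\<^sup>m)\<close> both letters act by bounded operators.\<close>

definition coord :: "nat \<Rightarrow> (nat \<Rightarrow>\<^sub>C 'b::real_normed_vector) \<Rightarrow>\<^sub>L 'b" where
  "coord m = q ^ m *\<^sub>R eval_op m"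

definition seq_of :: "(nat \<Rightarrow> 'b::real_normed_vector) \<Rightarrow> nat \<Rightarrow>\<^sub>C 'b" where
  "seq_of f = Bcontfun (\<lambda>m. f m /\<^sub>R q ^ m)"

lemma coord_apply: "coord m h = q ^ m *\<^sub>R h m"
  by (simp add: coord_def blinfun.scaleR_left)

lemma coord_eqI: "(\<And>m. coord m g = coord m h) \<Longrightarrow> g = h"
  using q by (intro bcontfun_eqI) (simp add: coord_apply)

lemma coord_map_op [simp]: "coord m (map_op T h) = T (coord m h)"
  by (simp add: coord_apply blinfun.scaleR_right)

lemma
  assumes norm_f: "\<And>m. norm (f m) \<le> B * q ^ m"
  shows coord_seq_of: "coord m (seq_of f) = f m"
    and norm_seq_of_le: "norm (seq_of f) \<le> B"
proof -
  have norm_scaled: "norm (f m /\<^sub>R q ^ m) \<le> B" for m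
    using norm_f [of m] q by (simp add: field_simps)
  have seq_of_apply: "seq_of f m = f m /\<^sub>R q ^ m" for m
    by (simp add: seq_of_def apply_Bcontfun_nat [OF norm_scaled])
  show "coord m (seq_of f) = f m"
    using q by (simp add: coord_apply seq_of_apply)
  show "norm (seq_of f) \<le> B"
    by (rule norm_bound) (simp only: seq_of_apply norm_scaled)
qed

text \<open>The kernel vanishes for \<open>m = 0\<close>, and \<open>conn_seq\<close> below at index 0, because \<open>conn m 0\<close> tends to 1
  instead of being \<open>O(q\<^sup>m)\<close>; the value of \<open>Y f\<close> at 0 is \<open>total_y\<close> instead.\<close>

definition y_kernel :: "nat \<Rightarrow> nat \<Rightarrow> real" where
  "y_kernel m a = (if 0 < m \<and> m < a then weight_y a * q ^ (a - m) else 0)"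

fun rep :: "letter \<Rightarrow> (nat \<Rightarrow>\<^sub>C 'b) \<Rightarrow>\<^sub>L (nat \<Rightarrow>\<^sub>C 'b::banach)" where
  "rep X = seq_op (\<lambda>m. weight_x m *\<^sub>R eval_op m)"
| "rep Y = seq_op (\<lambda>m. sum_op (y_kernel m))"

declare rep.simps [simp del]

definition total_y :: "(nat \<Rightarrow>\<^sub>C 'b) \<Rightarrow>\<^sub>L 'b::banach" where
  "total_y = sum_op (\<lambda>a. weight_y a * q ^ a)"

lemma norm_weight_x_eval_op_le: "norm (weight_x m *\<^sub>R eval_op m) \<le> 1"
  using mult_mono [OF weight_x_le_1 norm_eval_op_le [of m]] weight_x_nonneg by simp

lemma
  shows abs_summable_y_kernel: "y_kernel m abs_summable_on UNIV"
    and infsum_abs_y_kernel_le: "(\<Sum>\<^sub>\<infinity>a. \<bar>y_kernel m a\<bar>) \<le> 4 / (1 - q)"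
proof -
  have "\<bar>y_kernel m a\<bar> \<le> (if m \<le> a then 4 * q ^ (a - m) else 0)" for a
    using weight_y_nonneg [of a] weight_y_le [of a] q
    by (simp add: y_kernel_def abs_mult mult_right_mono)
  moreover have "\<bar>q\<bar> < 1" using q by simp
  ultimately show "y_kernel m abs_summable_on UNIV" "(\<Sum>\<^sub>\<infinity>a. \<bar>y_kernel m a\<bar>) \<le> 4 / (1 - q)"
    using abs_summable_on_geometric_bound infsum_abs_geometric_bound by blast+
qed

lemma norm_sum_op_y_kernel_le: "norm (sum_op (y_kernel m)) \<le> 4 / (1 - q)"
  by (rule order_trans [OF norm_sum_op_le [OF abs_summable_y_kernel] infsum_abs_y_kernel_le])

lemma norm_rep_X_le: "norm (rep X) \<le> 1"
  unfolding rep.simps by (rule norm_seq_op_le [OF norm_weight_x_eval_op_le])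

lemma norm_rep_Y_le: "norm (rep Y) \<le> 4 / (1 - q)"
  unfolding rep.simps by (rule norm_seq_op_le [OF norm_sum_op_y_kernel_le])

lemma abs_summable_total_y_kernel: "(\<lambda>a. weight_y a * q ^ a) abs_summable_on UNIV"
  using weight_y_nonneg weight_y_le q
  by (intro abs_summable_on_geometric_bound [where q = q and s = 0 and c = 4])
    (simp_all add: abs_mult mult_right_mono)

lemma abs_summable_weight_y_coord: "(\<lambda>a. weight_y a *\<^sub>R coord a h) abs_summable_on UNIV"
  using abs_summable_on_scaleR_bcontfun [OF abs_summable_total_y_kernel, of h]
  by (simp add: coord_apply)

lemma coord_rep_X: "coord m (rep X h) = weight_x m *\<^sub>R coord m h"
  by (simp add: rep.simps coord_apply seq_op_apply [OF norm_weight_x_eval_op_le]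
      blinfun.scaleR_left)

lemma coord_rep_Y:
  "coord m (rep Y h) = (if m = 0 then 0 else \<Sum>\<^sub>\<infinity>a\<in>{m<..}. weight_y a *\<^sub>R coord a h)"
proof -
  have "((\<lambda>a. y_kernel m a *\<^sub>R h a) has_sum rep Y h m) UNIV"
    using has_sum_sum_op [OF abs_summable_y_kernel [of m], of h]
    by (simp add: rep.simps seq_op_apply [OF norm_sum_op_y_kernel_le])
  then have "((\<lambda>a. q ^ m *\<^sub>R y_kernel m a *\<^sub>R h a) has_sum coord m (rep Y h)) UNIV"
    unfolding coord_apply by (intro has_sum_scaleR)
  then have "coord m (rep Y h) = (\<Sum>\<^sub>\<infinity>a. q ^ m *\<^sub>R y_kernel m a *\<^sub>R h a)"
    by (simp add: infsumI)
  also have "\<dots> = (if m = 0 then 0 else \<Sum>\<^sub>\<infinity>a\<in>{m<..}. weight_y a *\<^sub>R coord a h)"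
  proof (cases "m = 0")
    case False
    then have "(\<Sum>\<^sub>\<infinity>a. q ^ m *\<^sub>R y_kernel m a *\<^sub>R h a) =
        (\<Sum>\<^sub>\<infinity>a\<in>{m<..}. weight_y a *\<^sub>R coord a h)"
      by (intro infsum_cong_neutral)
        (auto simp: y_kernel_def coord_apply mult.left_commute simp flip: power_add)
    with False show ?thesis by simp
  qed (simp add: y_kernel_def)
  finally show ?thesis .
qed

lemma total_y_eq_infsum: "total_y h = (\<Sum>\<^sub>\<infinity>a\<in>{0<..}. weight_y a *\<^sub>R coord a h)"
proof -
  have "total_y h = (\<Sum>\<^sub>\<infinity>a. weight_y a *\<^sub>R coord a h)"
    using infsumI [OF has_sum_sum_op [OF abs_summable_total_y_kernel, of h]]
    by (simp add: total_y_def coord_apply)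
  also have "\<dots> = (\<Sum>\<^sub>\<infinity>a\<in>{0<..}. weight_y a *\<^sub>R coord a h)"
    by (rule infsum_cong_neutral) auto
  finally show ?thesis .
qed

lemma rep_map_op: "rep l (map_op T h) = map_op T (rep l h)"
proof (cases l)
  case X
  then show ?thesis
    by (intro coord_eqI) (simp add: coord_rep_X blinfun.scaleR_right)
next
  case Y
  then show ?thesis
    by (intro bcontfun_eqI) (simp add: rep.simps seq_op_apply [OF norm_sum_op_y_kernel_le]
        sum_op_map_op [OF abs_summable_y_kernel])
qed

lemma total_y_map_op: "total_y (map_op T h) = T (total_y h)"
  unfolding total_y_def by (rule sum_op_map_op [OF abs_summable_total_y_kernel])

lemma xi_eta_small: "\<xi> * \<eta> * (4 / (1 - q)) < 1"
proof -
  have "\<xi> * \<eta> < (1 - q) / 2 * (1 / 2)"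
    using q \<xi> \<eta> by (intro mult_strict_mono') auto
  then show ?thesis
    using q by (simp add: divide_less_eq)
qed

lemma yx_contraction_rep: "yx_contraction rep (\<xi> * \<eta>)"
proof
  have "norm (rep Y o\<^sub>L rep X) \<le> 4 / (1 - q) * 1"
    using q
    by (intro order_trans [OF norm_blinfun_compose mult_mono [OF norm_rep_Y_le norm_rep_X_le]])
      simp_all
  then have "\<bar>\<xi> * \<eta>\<bar> * norm (rep Y o\<^sub>L rep X) \<le> \<bar>\<xi> * \<eta>\<bar> * (4 / (1 - q) * 1)"
    by (rule mult_left_mono) simp
  also have "\<dots> < 1"
    using xi_eta_small \<xi> \<eta> by simp
  finally show "\<bar>\<xi> * \<eta>\<bar> * norm (rep Y o\<^sub>L rep X) < 1" .
qed

lemma coord_coord_rep_Y: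
  "coord n (coord m (rep Y h)) =
    (if m = 0 then 0 else \<Sum>\<^sub>\<infinity>a\<in>{m<..}. weight_y a *\<^sub>R coord n (coord a h))"
proof -
  have "coord n (coord m (rep Y h)) = coord m (rep Y (map_op (coord n) h))"
    by (simp only: rep_map_op coord_map_op)
  then show ?thesis by (simp only: coord_rep_Y coord_map_op)
qed

definition conn_seq :: "nat \<Rightarrow>\<^sub>C nat \<Rightarrow>\<^sub>C real" where
  "conn_seq = seq_of (\<lambda>m. seq_of (\<lambda>n. if 0 < m \<and> 0 < n then conn m n else 0))"

lemma coord_conn_seq: "coord n (coord m conn_seq) = (if 0 < m \<and> 0 < n then conn m n else 0)"
proof -
  define f where "f m n = (if 0 < m \<and> 0 < n then conn m n else 0)" for m n
  obtain B where "0 \<le> B" and B: "\<And>m n. \<bar>conn m n\<bar> \<le> B * q ^ (m * n)"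
    using conn_bound by blast
  have norm_f: "norm (f m n) \<le> B / q * q ^ m * q ^ n" for m n
  proof (cases "0 < m \<and> 0 < n")
    case True
    then obtain i j where [simp]: "m = Suc i" "n = Suc j" by (metis gr0_implies_Suc)
    have "q ^ (m * n) \<le> q ^ Suc (i + j)"
      using q by (intro power_decreasing) auto
    then have "\<bar>conn m n\<bar> \<le> B * q ^ Suc (i + j)"
      using B [of m n] \<open>0 \<le> B\<close> mult_left_mono order_trans by blast
    also have "B * q ^ Suc (i + j) = B / q * q ^ m * q ^ n"
      using q by (simp add: power_add)
    finally show ?thesis by (simp add: f_def)
  qed (use q \<open>0 \<le> B\<close> in \<open>auto simp: f_def\<close>)
  have "coord n (coord m conn_seq) = coord n (seq_of (f m))"
    unfolding conn_seq_def f_def [symmetric]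
    by (simp only: coord_seq_of [of "\<lambda>m. seq_of (f m)", OF norm_seq_of_le [OF norm_f]])
  then show ?thesis
    by (simp only: coord_seq_of [OF norm_f]) (simp only: f_def)
qed

lemma infsum_coord_conn_seq_left:
  "(\<Sum>\<^sub>\<infinity>a\<in>{m<..}. k a * coord n (coord a conn_seq)) =
    (if n = 0 then 0 else \<Sum>\<^sub>\<infinity>a\<in>{m<..}. k a * conn a n)"
  by (auto simp: coord_conn_seq intro!: infsum_cong infsum_0)

lemma infsum_coord_conn_seq_right:
  "(\<Sum>\<^sub>\<infinity>b\<in>{n<..}. k b * coord b (coord m conn_seq)) =
    (if m = 0 then 0 else \<Sum>\<^sub>\<infinity>b\<in>{n<..}. k b * conn b m)"
  by (auto simp: coord_conn_seq conn_commute [of m] intro!: infsum_cong infsum_0)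

definition x_seq :: "nat \<Rightarrow>\<^sub>C real" where
  "x_seq = seq_of weight_x"

lemma coord_x_seq: "coord m x_seq = weight_x m"
  unfolding x_seq_def
  by (rule coord_seq_of [where B = 1]) (simp add: weight_x_nonneg weight_x_le)

lemma total_y_conn_seq: "total_y conn_seq = x_seq"
proof (rule coord_eqI)
  fix n
  have "coord n (total_y conn_seq) = total_y (map_op (coord n) conn_seq)"
    by (simp add: total_y_map_op)
  also have "\<dots> = weight_x n"
    by (simp add: total_y_eq_infsum infsum_coord_conn_seq_left infsum_weight_y_conn_0)
  finally show "coord n (total_y conn_seq) = coord n x_seq"
    by (simp add: coord_x_seq)
qed

lemma map_op_total_y_conn_seq: "map_op total_y conn_seq = x_seq"
proof (rule coord_eqI)
  fix m
  have "coord m (map_op total_y conn_seq) = weight_x m"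
    by (simp add: total_y_eq_infsum infsum_coord_conn_seq_right infsum_weight_y_conn_0)
  then show "coord m (map_op total_y conn_seq) = coord m x_seq"
    by (simp add: coord_x_seq)
qed

lemma coord_rep_yx_conn_seq:
  "coord n (coord m (rep Y (rep X conn_seq))) = (if 0 < m \<and> 0 < n then yx_tail m n else 0)"
  by (simp add: coord_coord_rep_Y coord_rep_X blinfun.scaleR_right yx_tail_def
      infsum_coord_conn_seq_left flip: mult.assoc)

lemma rep_yx_conn_seq: "rep Y (rep X conn_seq) = map_op (rep Y) (map_op (rep X) conn_seq)"
proof (intro coord_eqI)
  fix m n
  have "coord n (coord m (map_op (rep Y) (map_op (rep X) conn_seq))) =
      (if 0 < m \<and> 0 < n then yx_tail n m else 0)"
    by (simp add: coord_rep_Y coord_rep_X yx_tail_def infsum_coord_conn_seq_right flip: mult.assoc)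
  then show "coord n (coord m (rep Y (rep X conn_seq))) =
      coord n (coord m (map_op (rep Y) (map_op (rep X) conn_seq)))"
    by (simp add: coord_rep_yx_conn_seq yx_tail_commute)
qed

lemma coord_rep_one_yx_conn_seq:
  "coord n (coord m (conn_seq + (\<xi> * \<eta>) *\<^sub>R rep Y (rep X conn_seq))) =
    (if 0 < m \<and> 0 < n then conn m n + \<xi> * \<eta> * yx_tail m n else 0)"
  by (simp add: blinfun.bilinear_simps coord_conn_seq coord_rep_yx_conn_seq)

lemma rep_Y_conn_seq:
  "rep Y conn_seq = map_op (rep X) (conn_seq + (\<xi> * \<eta>) *\<^sub>R rep Y (rep X conn_seq))"
proof (intro coord_eqI)
  fix m n
  show "coord n (coord m (rep Y conn_seq)) =
      coord n (coord m (map_op (rep X) (conn_seq + (\<xi> * \<eta>) *\<^sub>R rep Y (rep X conn_seq))))"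
    by (simp add: coord_coord_rep_Y infsum_coord_conn_seq_left infsum_weight_y_conn coord_rep_X
        coord_rep_one_yx_conn_seq)
qed

lemma map_op_rep_Y_conn_seq:
  "map_op (rep Y) conn_seq = rep X (conn_seq + (\<xi> * \<eta>) *\<^sub>R rep Y (rep X conn_seq))"
proof (intro coord_eqI)
  fix m n
  show "coord n (coord m (map_op (rep Y) conn_seq)) =
      coord n (coord m (rep X (conn_seq + (\<xi> * \<eta>) *\<^sub>R rep Y (rep X conn_seq))))"
    by (simp add: coord_rep_Y infsum_coord_conn_seq_right infsum_weight_y_conn coord_rep_X
        blinfun.scaleR_right coord_rep_one_yx_conn_seq conn_commute [of n] yx_tail_commute [of n])
qed

sublocale tau_transport rep "\<lambda>l. map_op (rep l)" "\<xi> * \<eta>" conn_seq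
proof (intro tau_transport.intro tau_transport_axioms.intro)
  show "yx_contraction rep (\<xi> * \<eta>)" "yx_contraction (\<lambda>l. map_op (rep l)) (\<xi> * \<eta>)"
    by (intro yx_contraction_map_op yx_contraction_rep)+
  show "rep k (map_op (rep l) g) = map_op (rep l) (rep k g)" for k l and g :: "nat \<Rightarrow>\<^sub>C nat \<Rightarrow>\<^sub>C real"
    by (rule rep_map_op)
  show "rep Y (rep X conn_seq) = map_op (rep Y) (map_op (rep X) conn_seq)"
    by (rule rep_yx_conn_seq)
  show "rep Y conn_seq =
      map_op (rep X) (conn_seq + (\<xi> * \<eta>) *\<^sub>R map_op (rep Y) (map_op (rep X) conn_seq))"
    using rep_Y_conn_seq unfolding rep_yx_conn_seq .
  show "map_op (rep Y) conn_seq = rep X (conn_seq + (\<xi> * \<eta>) *\<^sub>R rep Y (rep X conn_seq))"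
    by (rule map_op_rep_Y_conn_seq)
qed

theorem total_y_rep_fps_tau:
  assumes w: "w \<in> alg_A"
  shows "total_y (rep_fps rep (\<xi> * \<eta>) w x_seq) = total_y (rep_fps rep (\<xi> * \<eta>) (tau w) x_seq)"
proof -
  let ?right = "\<lambda>l. map_op (rep l)"
  have "map_op total_y (rep_fps rep (\<xi> * \<eta>) w conn_seq) = rep_fps rep (\<xi> * \<eta>) w x_seq"
    unfolding map_op_total_y_conn_seq [symmetric]
    by (rule rep_fps_intertwine [OF yx_contraction_rep yx_contraction_rep w])
      (simp only: rep_map_op)
  then have "total_y (rep_fps rep (\<xi> * \<eta>) w x_seq) =
      total_y (total_y (rep_fps rep (\<xi> * \<eta>) w conn_seq))"
    by (simp flip: total_y_map_op)
  also have "\<dots> = total_y (total_y (rep_fps ?right (\<xi> * \<eta>) (tau w) conn_seq))"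
    by (simp only: rep_fps_eq_rep_fps_tau [OF w])
  also have "total_y (rep_fps ?right (\<xi> * \<eta>) (tau w) conn_seq) =
      rep_fps rep (\<xi> * \<eta>) (tau w) x_seq"
    unfolding total_y_conn_seq [symmetric]
    by (rule rep_fps_intertwine [OF yx_contraction_map_op [OF yx_contraction_rep]
          yx_contraction_rep tau_in_A [OF w]]) (simp only: total_y_map_op)
  finally show ?thesis .
qed

section \<open>The defining series as iterated sums\<close>

fun act :: "letter \<Rightarrow> (nat \<Rightarrow> real) \<Rightarrow> nat \<Rightarrow> real" where
  "act X f m = weight_x m * f m"
| "act Y f m = (\<Sum>\<^sub>\<infinity>a\<in>{m<..}. weight_y a * f a)"

lemma act_X_funpow: "(act X ^^ k) f m = weight_x m ^ k * f m"
  by (induction k arbitrary: m) simp_all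

lemma foldr_act_weight_x: "0 < m \<Longrightarrow> foldr act v weight_x m = coord m (rep_word rep v x_seq)"
proof (induction v arbitrary: m)
  case Nil
  then show ?case by (simp add: coord_x_seq)
next
  case (Cons l v)
  then show ?case
    by (cases l) (auto simp: coord_rep_X coord_rep_Y intro!: infsum_cong)
qed

lemma letters_index_word_admissible:
  assumes "admissible ks"
  obtains v where "letters (index_word ks) = Y # v @ [X]"
  using assms bij_betw_apply [OF bij_betw_index_word, of ks] by auto

lemma act_X_one: "act X (\<lambda>_. 1) = weight_x"
  by (simp add: fun_eq_iff)

definition tuples_above :: "nat \<Rightarrow> nat \<Rightarrow> nat list set" where
  "tuples_above m r = {ms. length ms = r \<and> sorted_wrt (<) ms \<and> (\<forall>a\<in>set ms. m < a)}"

lemma tuples_above_0: "tuples_above 0 r = increasing_tuples r"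
  by (simp add: tuples_above_def increasing_tuples_def)

lemma O_term_Cons:
  assumes "1 \<le> k" and "0 < a"
  shows "O_term q \<xi> \<eta> (k # ks) (a # ms) =
    weight_y a * weight_x a ^ (k - 1) * O_term q \<xi> \<eta> ks ms"
proof -
  have "qbracket q a \<noteq> 0"
    using qbracket_ge_1 [OF assms(2)] by simp
  then have "qbracket q a powi (int (k - 1) - int 1) = qbracket q a ^ (k - 1) / qbracket q a ^ 1"
    by (subst power_int_diff) simp_all
  moreover have "int (k - 1) - int 1 = int k - 2"
    using assms by simp
  ultimately have "qbracket q a powi (int k - 2) = qbracket q a ^ (k - 1) / qbracket q a"
    by (simp only: power_one_right)
  then show ?thesis
    by (simp add: O_term_def weight_x_def weight_y_def prod.lessThan_Suc_shift power_divide
        power_mult [symmetric] mult.commute [of a] del: prod.lessThan_Suc)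
qed

lemma O_term_nonneg:
  assumes "\<forall>k\<in>set ks. 1 \<le> k" and "\<forall>a\<in>set ms. 0 < a" and "length ms = length ks"
  shows "0 \<le> O_term q \<xi> \<eta> ks ms"
  using assms(3,1,2)
proof (induction ms ks rule: list_induct2)
  case Nil
  show ?case by (simp add: O_term_def)
next
  case (Cons a ms k ks)
  then show ?case
    by (simp add: O_term_Cons weight_x_nonneg weight_y_nonneg)
qed

lemma has_sum_O_term_Cons:
  assumes ks: "\<forall>k\<in>set (k # ks). 1 \<le> k"
    and f: "\<And>a. (O_term q \<xi> \<eta> ks has_sum f a) (tuples_above a (length ks))"
    and summable: "(\<lambda>a. weight_y a * (weight_x a ^ (k - 1) * f a)) summable_on {m<..}"
  shows "(O_term q \<xi> \<eta> (k # ks) has_sum (\<Sum>\<^sub>\<infinity>a\<in>{m<..}. weight_y a * (weight_x a ^ (k - 1) * f a)))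
      (tuples_above m (length (k # ks)))"
proof -
  let ?h = "\<lambda>(a, ms). O_term q \<xi> \<eta> (k # ks) (a # ms)"
  let ?g = "\<lambda>a. weight_y a * (weight_x a ^ (k - 1) * f a)"
  have inner: "((\<lambda>ms. ?h (a, ms)) has_sum ?g a) (tuples_above a (length ks))" if "a \<in> {m<..}" for a
    using has_sum_cmult_right [OF f, of "weight_y a * weight_x a ^ (k - 1)" a] that ks
    by (simp add: O_term_Cons mult.assoc)
  have "?h summable_on (SIGMA a:{m<..}. tuples_above a (length ks))"
  proof (rule summable_on_SigmaI [OF inner summable])
    fix a ms assume "a \<in> {m<..}" "ms \<in> tuples_above a (length ks)"
    moreover from this have "\<forall>b\<in>set ms. 0 < b"
      by (force simp: tuples_above_def)
    ultimately show "0 \<le> ?h (a, ms)"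
      using ks by (auto simp: tuples_above_def intro!: O_term_nonneg)
  qed
  then have "(?h has_sum infsum ?g {m<..}) (SIGMA a:{m<..}. tuples_above a (length ks))"
    using summable by (intro has_sum_SigmaI [OF inner]) simp_all
  then show ?thesis
    by (rule has_sum_reindex_bij_witness
        [where i = "\<lambda>ms. (hd ms, tl ms)" and j = "\<lambda>(a, ms). a # ms", THEN iffD1, rotated -1])
      (auto simp: tuples_above_def length_Suc_conv)
qed

lemma summable_weight_y_foldr_act:
  assumes "admissible (k # ks)"
  shows "(\<lambda>a. weight_y a * (weight_x a ^ (k - 1) * foldr act (letters (index_word ks)) (\<lambda>_. 1) a))
    summable_on {m<..}"
proof -
  obtain v where "letters (index_word (k # ks)) = Y # v @ [X]"
    using letters_index_word_admissible [OF assms] .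
  then have "replicate (k - 1) X @ letters (index_word ks) = v @ [X]"
    by simp
  then have "foldr act (replicate (k - 1) X @ letters (index_word ks)) (\<lambda>_. 1) =
      foldr act v weight_x"
    by (simp only: foldr_append foldr.simps o_apply id_apply act_X_one)
  then have foldr_act_eq: "weight_x a ^ (k - 1) * foldr act (letters (index_word ks)) (\<lambda>_. 1) a =
      foldr act v weight_x a" for a
    by (simp add: fun_eq_iff act_X_funpow)
  have "(\<lambda>a. weight_y a * coord a (rep_word rep v x_seq)) summable_on {m<..}"
    using summable_on_subset_banach [OF abs_summable_summable
        [OF abs_summable_weight_y_coord [of "rep_word rep v x_seq"]], of "{m<..}"] by simp
  then show ?thesis
    unfolding foldr_act_eq
    by (rule summable_on_cong [THEN iffD1, rotated]) (auto simp: foldr_act_weight_x)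
qed

lemma has_sum_O_term:
  assumes "\<forall>k\<in>set ks. 1 \<le> k" and "ks \<noteq> [] \<Longrightarrow> 2 \<le> last ks"
  shows "(O_term q \<xi> \<eta> ks has_sum foldr act (letters (index_word ks)) (\<lambda>_. 1) m)
    (tuples_above m (length ks))"
  using assms
proof (induction ks arbitrary: m)
  case Nil
  have "tuples_above m 0 = {[]}"
    by (auto simp: tuples_above_def)
  then show ?case
    by (simp add: O_term_def has_sum_finiteI)
next
  case (Cons k ks)
  have "admissible (k # ks)"
    using Cons.prems by (simp add: admissible_def)
  moreover have "foldr act (letters (index_word (k # ks))) (\<lambda>_. 1) m = (\<Sum>\<^sub>\<infinity>a\<in>{m<..}.
      weight_y a * (weight_x a ^ (k - 1) * foldr act (letters (index_word ks)) (\<lambda>_. 1) a))"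
    by (simp add: act_X_funpow)
  moreover have "(O_term q \<xi> \<eta> ks has_sum foldr act (letters (index_word ks)) (\<lambda>_. 1) a)
      (tuples_above a (length ks))" for a
    using Cons.prems by (intro Cons.IH) (auto split: if_splits)
  ultimately show ?case
    using has_sum_O_term_Cons [OF Cons.prems(1)] summable_weight_y_foldr_act by simp
qed

lemma has_sum_O_term_admissible:
  assumes "admissible ks"
  shows "(O_term q \<xi> \<eta> ks has_sum foldr act (letters (index_word ks)) (\<lambda>_. 1) 0)
    (increasing_tuples (length ks))"
  using has_sum_O_term [of ks 0] assms by (simp add: admissible_def tuples_above_0)

lemma O_term_abs_summable:
  assumes "admissible ks"
  shows "O_term q \<xi> \<eta> ks abs_summable_on increasing_tuples (length ks)"
  using has_sum_imp_summable [OF has_sum_O_term_admissible [OF assms]]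
  by (rule summable_on_iff_abs_summable_on_real [THEN iffD1])

lemma O_index_eq_total_y:
  assumes "admissible ks" and v: "letters (index_word ks) = Y # v @ [X]"
  shows "O_index q \<xi> \<eta> ks = total_y (rep_word rep v x_seq)"
proof -
  have "O_index q \<xi> \<eta> ks = foldr act (Y # v @ [X]) (\<lambda>_. 1) 0"
    using infsumI [OF has_sum_O_term_admissible [OF assms(1)]] unfolding O_index_def v .
  also have "\<dots> = (\<Sum>\<^sub>\<infinity>a\<in>{0<..}. weight_y a * foldr act v weight_x a)"
    by (simp add: act_X_one)
  also have "\<dots> = total_y (rep_word rep v x_seq)"
    by (auto simp: total_y_eq_infsum foldr_act_weight_x intro!: infsum_cong)
  finally show ?thesis .
qed

lemma O_poly_eq_total_y:
  "O_poly q \<xi> \<eta> (monomial [Y] * p * monomial [X]) = total_y (rep_poly rep p x_seq)"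
proof (induction p rule: nc_poly_induct)
  case zero
  show ?case by (simp add: O_poly_def)
next
  case (single v c)
  let ?w = "Word (Y # letters v @ [X])"
  have "?w \<in> index_word ` {ks. admissible ks}"
    unfolding bij_betw_imp_surj_on [OF bij_betw_index_word] by auto
  then obtain ks where ks: "admissible ks" "index_word ks = ?w"
    by force
  then have "monomial [Y] * Poly_Mapping.single v c * monomial [X] =
      Poly_Mapping.single (index_word ks) c"
    by (simp add: mult_single plus_word_def)
  moreover have "O_index q \<xi> \<eta> ks = total_y (rep_word rep (letters v) x_seq)"
    using ks by (intro O_index_eq_total_y) simp_all
  ultimately show ?case
    by (simp add: O_poly_index [OF ks(1)] rep_poly_single blinfun.bilinear_simps)
next
  case (add p r)
  then show ?case
    by (simp add: distrib_left distrib_right O_poly_add rep_poly_add blinfun.bilinear_simps)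
qed

lemma O_poly_nth_eq_total_y:
  "O_poly q \<xi> \<eta> (fps_nth (gen_y * w * gen_x) i) * \<xi> ^ i * \<eta> ^ i =
    total_y (rep_term rep (\<xi> * \<eta>) w i x_seq)"
  by (simp add: gen_x_def gen_y_def O_poly_eq_total_y rep_term_def blinfun.bilinear_simps
      power_mult_distrib)

lemma O_poly_nth_abs_summable:
  assumes "w \<in> alg_A"
  shows "summable (\<lambda>i. \<bar>O_poly q \<xi> \<eta> (fps_nth (gen_y * w * gen_x) i) * \<xi> ^ i * \<eta> ^ i\<bar>)"
  unfolding O_poly_nth_eq_total_y
  using yx_contraction.summable_blinfun_rep_term [OF yx_contraction_rep assms, of total_y x_seq]
  by simp

lemma O_series_eq_total_y:
  assumes "w \<in> alg_A"
  shows "O_series q \<xi> \<eta> (gen_y * w * gen_x) = total_y (rep_fps rep (\<xi> * \<eta>) w x_seq)"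
proof -
  have "(\<lambda>i. total_y (rep_term rep (\<xi> * \<eta>) w i x_seq)) sums
      total_y (rep_fps rep (\<xi> * \<eta>) w x_seq)"
    by (intro bounded_linear.sums [OF blinfun.bounded_linear_right]
        yx_contraction.rep_term_apply_sums yx_contraction_rep assms)
  then show ?thesis
    unfolding O_series_def O_poly_nth_eq_total_y by (rule sums_unique [symmetric])
qed

theorem O_series_tau:
  assumes "w \<in> alg_A"
  shows "O_series q \<xi> \<eta> (gen_y * w * gen_x) = O_series q \<xi> \<eta> (gen_y * tau w * gen_x)"
  using total_y_rep_fps_tau [OF assms] by (simp add: O_series_eq_total_y assms tau_in_A)

end

theorem theorem1p2:
  fixes q :: real
  assumes "0 < q" and "q < 1"
  shows "\<exists>\<delta>>0. \<forall>\<xi> \<eta>. 0 \<le> \<xi> \<and> \<xi> < \<delta> \<and> 0 \<le> \<eta> \<and> \<eta> < \<delta> \<longrightarrow>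
    (\<forall>ks. admissible ks \<longrightarrow> O_term q \<xi> \<eta> ks abs_summable_on increasing_tuples (length ks)) \<and>
    (\<forall>w\<in>alg_A.
      summable (\<lambda>i. \<bar>O_poly q \<xi> \<eta> (fps_nth (gen_y * w * gen_x) i) * \<xi> ^ i * \<eta> ^ i\<bar>) \<and>
      O_series q \<xi> \<eta> (gen_y * w * gen_x) = O_series q \<xi> \<eta> (gen_y * tau w * gen_x))"
proof (intro exI [of _ "(1 - q) / 2"] conjI allI impI ballI)
  show "0 < (1 - q) / 2"
    using assms by simp
  fix \<xi> \<eta> :: real and ks w
  assume "0 \<le> \<xi> \<and> \<xi> < (1 - q) / 2 \<and> 0 \<le> \<eta> \<and> \<eta> < (1 - q) / 2"
  with assms interpret connected_sum q \<xi> \<eta>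
    by unfold_locales auto
  show "O_term q \<xi> \<eta> ks abs_summable_on increasing_tuples (length ks)" if "admissible ks"
    using that by (rule O_term_abs_summable)
  assume "w \<in> alg_A"
  then show "summable (\<lambda>i. \<bar>O_poly q \<xi> \<eta> (fps_nth (gen_y * w * gen_x) i) * \<xi> ^ i * \<eta> ^ i\<bar>)"
    and "O_series q \<xi> \<eta> (gen_y * w * gen_x) = O_series q \<xi> \<eta> (gen_y * tau w * gen_x)"
    by (rule O_poly_nth_abs_summable, rule O_series_tau)
qed

end
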